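(* In the setting of the symplectic doubling described in the context, every relative invariant of the affine $\mathbb G_m\times G\times G$-variety $X$ is of the form $c(f^{\pm})^m$ with $c\in F^\times$, $m\in\mathbb Z$, and the monoid $\Lambda_X$ is generated by the character $\omega_1:(t,g_1,g_2)\mapsto t$. Consequently the affine spherical embedding $X^+\hookrightarrow X$ satisfies: (G1) $\mathbb Q_{\ge0}\Lambda_X$ is a simplicial cone in $\Lambda\otimes\mathbb Q$, and (G2) $X\smallsetminus X^+$ is the zero locus of the relative invariant $f^+$ with eigencharacter the generator $\omega_1$.
   Context: $F$ is a field of characteristic zero (in the paper a local field), $V\ne0$ a symplectic $F$-vector space of dimension $2n$, $G=\mathrm{Sp}(V)$, $V^\Box=V\oplus V$ with form $\langle\cdot|\cdot\rangle\oplus(-\langle\cdot|\cdot\rangle)$, $G^\Box=\mathrm{Sp}(V^\Box)$ acting on the right of $V^\Box$ and $\bigwedge V^\Box$, $G\times G\subset G^\Box$, $V^\Delta$ the diagonal, $V^+=V\oplus0$, $V^-=0\oplus V$. $X_P\subset\bigwedge^{2n}V^\Box\smallsetminus\{0\}$ is the set of nonzero vectors spanning $\bigwedge^{\max}\ell$ for lagrangians $\ell$, with $\mathbb G_m\times G^\Box$ acting by $\Lambda(t,g)=t\Lambda g$; $X=X_P\sqcup\{0\}$ its closure (affine); $X^+\subset X$ the open $\mathbb G_m\times G\times G$-orbit (those $\Lambda$ whose lagrangian meets $V^+$ trivially). $f^{\pm}:X\to\bigwedge^{\max}V^\Box\cong\mathbb G_a$, $\Lambda\mapsto\Lambda\wedge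 v^{\pm}$ with $0\ne v^\pm\in\bigwedge^{\max}V^\pm$. A relative invariant is $0\ne f\in F[X]$ with $f(x h)=\omega(h)f(x)$ for a character $\omega$; $\Lambda$ is the group of eigencharacters of eigenfunctions in $F(X^+)$ and $\Lambda_X$ the monoid of eigencharacters of relative invariants. *)

theory Defs
  imports "HOL-Combinatorics.Permutations"
begin

text \<open>Coordinates. V = F^(2n) with indices 0..<2n; the doubled space V-box = F^(4n),
  indices 0..<2n form V-plus = V (+) 0 and indices 2n..<4n form V-minus = 0 (+) V.
  Vectors are functions nat => F read on the relevant index range; matrices are
  functions nat => nat => F. Groups act on the right: (v g)_j = sum_i v_i g_i_j.\<close>

definition symplectic_gram :: "nat \<Rightarrow> (nat \<Rightarrow> nat \<Rightarrow> 'a::field) \<Rightarrow> bool" where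
  "symplectic_gram n J \<longleftrightarrow>
     (\<forall>i j. (2*n \<le> i \<or> 2*n \<le> j) \<longrightarrow> J i j = 0) \<and>
     (\<forall>i j. J i j = - J j i) \<and>
     (\<forall>v::nat \<Rightarrow> 'a. (\<forall>j<2*n. (\<Sum>i<2*n. v i * J i j) = 0) \<longrightarrow> (\<forall>i<2*n. v i = 0))"

definition Sp :: "nat \<Rightarrow> (nat \<Rightarrow> nat \<Rightarrow> 'a::field) \<Rightarrow> (nat \<Rightarrow> nat \<Rightarrow> 'a) set" where
  "Sp n J = {g. (\<forall>i j. (2*n \<le> i \<or> 2*n \<le> j) \<longrightarrow> g i j = 0) \<and>
     (\<forall>i<2*n. \<forall>j<2*n. (\<Sum>k<2*n. \<Sum>l<2*n. g i k * J k l * g j l) = J i j)}"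

definition bform :: "nat \<Rightarrow> (nat \<Rightarrow> nat \<Rightarrow> 'a::field) \<Rightarrow> (nat \<Rightarrow> 'a) \<Rightarrow> (nat \<Rightarrow> 'a) \<Rightarrow> 'a" where
  "bform n J u v =
     (\<Sum>i<2*n. \<Sum>j<2*n. u i * J i j * v j) -
     (\<Sum>i<2*n. \<Sum>j<2*n. u (2*n+i) * J i j * v (2*n+j))"

definition detL :: "nat \<Rightarrow> (nat \<Rightarrow> nat \<Rightarrow> 'a::comm_ring_1) \<Rightarrow> 'a" where
  "detL k A = (\<Sum>p | p permutes {..<k}. of_int (sign p) * (\<Prod>i<k. A i (p i)))"

text \<open>Index sets of the standard basis of the exterior power wedge^(2n) V-box:
  the 2n-element subsets of {0..<4n}. An element of wedge^(2n) V-box is a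
  coefficient function on these subsets (zero elsewhere).\<close>
definition ksub :: "nat \<Rightarrow> nat set set" where
  "ksub n = {S. S \<subseteq> {..<4*n} \<and> card S = 2*n}"

type_synonym 'a wedge = "nat set \<Rightarrow> 'a"

definition wedge_vecs :: "nat \<Rightarrow> (nat \<Rightarrow> nat \<Rightarrow> 'a::comm_ring_1) \<Rightarrow> 'a wedge" where
  "wedge_vecs n w S =
     (if S \<in> ksub n then detL (2*n) (\<lambda>i j. w i (sorted_list_of_set S ! j)) else 0)"

text \<open>Right action of a 4n x 4n matrix g on wedge^(2n) V-box (via Cauchy--Binet:
  (w_0 /\ ... ) g = (w_0 g) /\ ...).\<close>
definition wedge_act :: "nat \<Rightarrow> (nat \<Rightarrow> nat \<Rightarrow> 'a::comm_ring_1) \<Rightarrow> 'a wedge \<Rightarrow> 'a wedge" where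
  "wedge_act n g L T =
     (if T \<in> ksub n then
        (\<Sum>S\<in>ksub n. L S * detL (2*n)
            (\<lambda>i j. g (sorted_list_of_set S ! i) (sorted_list_of_set T ! j)))
      else 0)"

definition blockdiag :: "nat \<Rightarrow> (nat \<Rightarrow> nat \<Rightarrow> 'a::zero) \<Rightarrow> (nat \<Rightarrow> nat \<Rightarrow> 'a) \<Rightarrow> nat \<Rightarrow> nat \<Rightarrow> 'a" where
  "blockdiag n g1 g2 i j =
     (if i < 2*n \<and> j < 2*n then g1 i j
      else if 2*n \<le> i \<and> 2*n \<le> j \<and> i < 4*n \<and> j < 4*n then g2 (i - 2*n) (j - 2*n)
      else 0)"

definition Hgrp :: "nat \<Rightarrow> (nat \<Rightarrow> nat \<Rightarrow> 'a::field) \<Rightarrow>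
    ('a \<times> (nat \<Rightarrow> nat \<Rightarrow> 'a) \<times> (nat \<Rightarrow> nat \<Rightarrow> 'a)) set" where
  "Hgrp n J = {(t, g1, g2). t \<noteq> 0 \<and> g1 \<in> Sp n J \<and> g2 \<in> Sp n J}"

definition hact :: "nat \<Rightarrow> 'a::comm_ring_1 wedge \<Rightarrow>
    ('a \<times> (nat \<Rightarrow> nat \<Rightarrow> 'a) \<times> (nat \<Rightarrow> nat \<Rightarrow> 'a)) \<Rightarrow> 'a wedge" where
  "hact n L h = (case h of (t, g1, g2) \<Rightarrow> (\<lambda>T. t * wedge_act n (blockdiag n g1 g2) L T))"

text \<open>Families w_0..w_(2n-1) in V-box spanning a lagrangian (isotropic, 2n independent
  vectors; independence is equivalent to nonvanishing of their wedge).\<close>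
definition lagr_basis :: "nat \<Rightarrow> (nat \<Rightarrow> nat \<Rightarrow> 'a::field) \<Rightarrow> (nat \<Rightarrow> nat \<Rightarrow> 'a) \<Rightarrow> bool" where
  "lagr_basis n J w \<longleftrightarrow>
     (\<forall>i<2*n. \<forall>j<2*n. bform n J (w i) (w j) = 0) \<and> wedge_vecs n w \<noteq> (\<lambda>_. 0)"

definition XP :: "nat \<Rightarrow> (nat \<Rightarrow> nat \<Rightarrow> 'a::field) \<Rightarrow> 'a wedge set" where
  "XP n J = {wedge_vecs n w | w. lagr_basis n J w}"

definition Xvar :: "nat \<Rightarrow> (nat \<Rightarrow> nat \<Rightarrow> 'a::field) \<Rightarrow> 'a wedge set" where
  "Xvar n J = insert (\<lambda>_. 0) (XP n J)"

text \<open>X^+: those Lambda whose lagrangian meets V-plus = V (+) 0 trivially.\<close>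
definition Xplus :: "nat \<Rightarrow> (nat \<Rightarrow> nat \<Rightarrow> 'a::field) \<Rightarrow> 'a wedge set" where
  "Xplus n J = {wedge_vecs n w | w. lagr_basis n J w \<and>
     (\<forall>c::nat \<Rightarrow> 'a.
        (\<forall>j. 2*n \<le> j \<and> j < 4*n \<longrightarrow> (\<Sum>i<2*n. c i * w i j) = 0) \<longrightarrow>
        (\<forall>j<4*n. (\<Sum>i<2*n. c i * w i j) = 0))}"

text \<open>Polynomial functions on wedge^(2n) V-box (generated by constants and the
  coordinate functions); F[X] consists of their restrictions to X.\<close>
inductive polyfun :: "('a::comm_ring_1 wedge \<Rightarrow> 'a) \<Rightarrow> bool" where
  pf_const: "polyfun (\<lambda>_. c)"
| pf_coord: "polyfun (\<lambda>L. L S)"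
| pf_add: "polyfun f \<Longrightarrow> polyfun g \<Longrightarrow> polyfun (\<lambda>L. f L + g L)"
| pf_mult: "polyfun f \<Longrightarrow> polyfun g \<Longrightarrow> polyfun (\<lambda>L. f L * g L)"

definition rel_inv :: "nat \<Rightarrow> (nat \<Rightarrow> nat \<Rightarrow> 'a::field) \<Rightarrow> ('a wedge \<Rightarrow> 'a) \<Rightarrow>
    ('a \<times> (nat \<Rightarrow> nat \<Rightarrow> 'a) \<times> (nat \<Rightarrow> nat \<Rightarrow> 'a) \<Rightarrow> 'a) \<Rightarrow> bool" where
  "rel_inv n J f \<omega> \<longleftrightarrow> polyfun f \<and> (\<exists>x\<in>Xvar n J. f x \<noteq> 0) \<and>
     (\<forall>x\<in>Xvar n J. \<forall>h\<in>Hgrp n J. f (hact n x h) = \<omega> h * f x)"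

text \<open>f^+(Lambda) = Lambda /\ v^+ with v^+ = e_0 /\ ... /\ e_(2n-1) (basis of V-plus):
  only the coordinate at {2n..<4n} survives (the sign is +1). Likewise f^-.\<close>
definition fplus :: "nat \<Rightarrow> 'a wedge \<Rightarrow> 'a" where
  "fplus n L = L {2*n..<4*n}"

definition fminus :: "nat \<Rightarrow> 'a wedge \<Rightarrow> 'a" where
  "fminus n L = L {..<2*n}"

end

theory Submission
  imports Defs "Jordan_Normal_Form.Determinant"
begin

text \<open>
  A lagrangian transversal to \<open>V\<^sup>+\<close> is the graph of a symplectic \<open>g\<close>, so every point of \<open>X\<^sup>+\<close> is
  \<open>t \<cdot> x\<^sub>0 \<cdot> (g, 1)\<close>, with \<open>x\<^sub>0\<close> the diagonal and \<open>t\<close> its value under \<open>f\<^sup>+\<close>. An eigencharacter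
  restricted to a one-parameter group of transvections is a polynomial additive character, hence
  trivial; since products of transvections take any \<open>g\<close> to the identity, it is trivial on
  \<open>Sp(V)\<close> (the same argument gives \<open>det g = 1\<close>). On the scalars it is a polynomial multiplicative
  character, hence a power \<open>t\<^sup>m\<close>. So a relative invariant agrees with \<open>c (f\<^sup>+)\<^sup>m\<close> on \<open>X\<^sup>+\<close>, and
  moving a lagrangian along transvections of the doubled space shows that \<open>X\<^sup>+\<close> is Zariski dense
  in \<open>X\<close>.
\<close>

section \<open>Determinants and linear independence\<close>

text \<open>In \<open>rel_inv\<close> the eigencharacter \<open>\<omega>\<close> is just some
  function, so that it is a character, and an algebraic one, has to be derived. The base point does
  this: density supplies a point of \<open>X^+\<close> where \<open>f\<close> is nonzero,
  transitivity turns that into \<open>f x0 \<noteq> 0\<close>, and then \<open>\<omega>\<close> at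
  (t, g, 1) equals the value of \<open>f\<close> at t x0 (g, 1) divided by the constant
  \<open>f x0\<close>. Hence it is multiplicative and inherits from \<open>f\<close> a polynomial
  dependence on every parameter. In particular it is polynomial in t, which excludes negative
  exponents.

  The field is not assumed algebraically closed and X is a set of rational points, so closure
  arguments are replaced by polynomial curves inside X: characteristic zero makes the field
  infinite, and a polynomial that is nonzero at s = 0 stays nonzero at some other s.\<close>

lemma detL_cong:
  assumes "\<And>i j. i < k \<Longrightarrow> j < k \<Longrightarrow> A i j = B i j"
  shows "detL k A = detL k B"
  unfolding detL_def
proof (intro sum.cong refl arg_cong2[where f="(*)"] prod.cong)
  fix p i assume "p \<in> {p. p permutes {..<k}}" "i \<in> {..<k}"
  then show "A i (p i) = B i (p i)"
    using assms permutes_in_image[of p "{..<k}" i] by auto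
qed

text \<open>This bridge brings the determinant theory of matrices to functions on index
  pairs.\<close>

lemma detL_eq_det: "detL k A = det (mat k k (\<lambda>(i,j). A i j))"
proof -
  have "det (mat k k (\<lambda>(i,j). A i j)) =
      (\<Sum>p | p permutes {0..<k}. signof p * (\<Prod>i = 0..<k. mat k k (\<lambda>(i,j). A i j) $$ (i, p i)))"
    by (rule det_def') simp
  also have "\<dots> = detL k A"
    unfolding detL_def atLeast0LessThan
  proof (intro sum.cong refl arg_cong2[where f="(*)"] prod.cong)
    fix p i assume "p \<in> {p. p permutes {..<k}}" "i \<in> {..<k}"
    then show "mat k k (\<lambda>(i,j). A i j) $$ (i, p i) = A i (p i)"
      using permutes_in_image[of p "{..<k}" i] by auto
  qed 
  finally show ?thesis by simp
qed

text \<open>Only the inner dimension is recorded, so that the same product serves for base changes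
  of a 2n-row family and for the action of 4n x 4n matrices on it.\<close>

definition matmul :: "nat \<Rightarrow> (nat \<Rightarrow> nat \<Rightarrow> 'a::comm_ring_1) \<Rightarrow> (nat \<Rightarrow> nat \<Rightarrow> 'a) \<Rightarrow> nat \<Rightarrow> nat \<Rightarrow> 'a" where
  "matmul N A B i j = (\<Sum>k<N. A i k * B k j)"

definition vecmul :: "nat \<Rightarrow> (nat \<Rightarrow> 'a::comm_ring_1) \<Rightarrow> (nat \<Rightarrow> nat \<Rightarrow> 'a) \<Rightarrow> nat \<Rightarrow> 'a" where
  "vecmul N v A j = (\<Sum>i<N. v i * A i j)"

text \<open>It vanishes outside the square because \<open>Sp\<close> requires this of its
  elements.\<close>

definition idmat :: "nat \<Rightarrow> nat \<Rightarrow> nat \<Rightarrow> 'a::comm_ring_1" where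
  "idmat N i j = (if i < N \<and> i = j then 1 else 0)"

lemma detL_matmul: "detL N (matmul N A B) = detL N A * detL N B"
proof -
  have "mat N N (\<lambda>(i,j). matmul N A B i j) = mat N N (\<lambda>(i,j). A i j) * mat N N (\<lambda>(i,j). B i j)"
    by (rule eq_matI) (auto simp: matmul_def scalar_prod_def atLeast0LessThan)
  then show ?thesis
    by (simp add: detL_eq_det det_mult[of _ N])
qed

lemma detL_idmat: "detL N (idmat N) = (1::'a::comm_ring_1)"
proof -
  have "mat N N (\<lambda>(i,j). idmat N i j :: 'a) = 1\<^sub>m N"
    by (rule eq_matI) (auto simp: idmat_def)
  then show ?thesis unfolding detL_eq_det by simp
qed

lemma detL_transpose: "detL N (\<lambda>i j. A j i) = detL N A"
proof -
  have "mat N N (\<lambda>(i,j). A j i) = transpose_mat (mat N N (\<lambda>(i,j). A i j))"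
    by (rule eq_matI) auto
  then show ?thesis by (simp add: detL_eq_det det_transpose[of _ N])
qed

lemma detL_permute_rows:
  assumes "p permutes {..<N}"
  shows "detL N (\<lambda>i. A (p i)) = of_int (sign p) * detL N A"
proof -
  have "mat N N (\<lambda>(i,j). A (p i) j) = mat N N (\<lambda>(i,j). mat N N (\<lambda>(i,j). A i j) $$ (p i, j))"
    using permutes_in_image[OF assms] by (intro eq_matI) auto
  then show ?thesis
    using det_permute_rows[of "mat N N (\<lambda>(i,j). A i j)" N p] assms
    by (simp add: detL_eq_det atLeast0LessThan)
qed

lemma detL_identical_rows:
  assumes "i < N" "j < N" "i \<noteq> j" "A i = A j"
  shows "detL N A = 0"
proof -
  have "row (mat N N (\<lambda>(i,j). A i j)) i = row (mat N N (\<lambda>(i,j). A i j)) j"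
    using assms by (intro eq_vecI) auto
  then show ?thesis
    using assms by (simp add: detL_eq_det det_identical_rows[of _ N i j])
qed

lemma detL_eq_0_iff_right_kernel:
  fixes A :: "nat \<Rightarrow> nat \<Rightarrow> 'a::field"
  shows "detL N A = 0 \<longleftrightarrow> (\<exists>y. (\<exists>j<N. y j \<noteq> 0) \<and> (\<forall>i<N. (\<Sum>j<N. A i j * y j) = 0))"
proof -
  let ?A = "mat N N (\<lambda>(i,j). A i j)"
  have A: "?A \<in> carrier_mat N N" by simp
  show ?thesis
    unfolding detL_eq_det det_0_iff_vec_prod_zero_field[OF A]
  proof
    assume "\<exists>v. v \<in> carrier_vec N \<and> v \<noteq> 0\<^sub>v N \<and> ?A *\<^sub>v v = 0\<^sub>v N"
    then obtain v where v: "v \<in> carrier_vec N" "v \<noteq> 0\<^sub>v N" and Av: "?A *\<^sub>v v = 0\<^sub>v N" by blast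
    have "\<exists>j<N. v $ j \<noteq> 0"
      using v by (metis carrier_vecD eq_vecI index_zero_vec)
    moreover have "(\<Sum>j<N. A i j * v $ j) = 0" if "i < N" for i
    proof -
      have "(?A *\<^sub>v v) $ i = 0" using Av that by simp
      then show ?thesis using that v by (simp add: scalar_prod_def atLeast0LessThan)
    qed
    ultimately show "\<exists>y. (\<exists>j<N. y j \<noteq> 0) \<and> (\<forall>i<N. (\<Sum>j<N. A i j * y j) = 0)" by blast
  next
    assume "\<exists>y. (\<exists>j<N. y j \<noteq> 0) \<and> (\<forall>i<N. (\<Sum>j<N. A i j * y j) = 0)"
    then obtain y j where y: "j < N" "y j \<noteq> 0" "\<forall>i<N. (\<Sum>j<N. A i j * y j) = 0" by blast
    have "vec N y \<noteq> 0\<^sub>v N"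
      using y by (metis index_vec index_zero_vec(1))
    moreover have "?A *\<^sub>v vec N y = 0\<^sub>v N"
      using y by (intro eq_vecI) (auto simp: scalar_prod_def atLeast0LessThan)
    ultimately show "\<exists>v. v \<in> carrier_vec N \<and> v \<noteq> 0\<^sub>v N \<and> ?A *\<^sub>v v = 0\<^sub>v N"
      by (intro exI[of _ "vec N y"]) simp
  qed
qed

lemma detL_eq_0_iff_left_kernel:
  fixes A :: "nat \<Rightarrow> nat \<Rightarrow> 'a::field"
  shows "detL N A = 0 \<longleftrightarrow> (\<exists>e. (\<exists>i<N. e i \<noteq> 0) \<and> (\<forall>j<N. (\<Sum>i<N. e i * A i j) = 0))"
  using detL_eq_0_iff_right_kernel[of N "\<lambda>i j. A j i", unfolded detL_transpose[of N A]]
  by (simp add: mult.commute)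

lemma detL_inverse:
  fixes A :: "nat \<Rightarrow> nat \<Rightarrow> 'a::field"
  assumes "detL N A \<noteq> 0"
  shows "\<exists>B. \<forall>i<N. \<forall>j<N. matmul N A B i j = idmat N i j \<and> matmul N B A i j = idmat N i j"
proof -
  let ?A = "mat N N (\<lambda>(i,j). A i j)"
  have "?A \<in> Units (ring_mat TYPE('a) N ())"
    using assms by (intro det_non_zero_imp_unit) (auto simp: detL_eq_det)
  then obtain B where B: "B \<in> carrier_mat N N" "B * ?A = 1\<^sub>m N" "?A * B = 1\<^sub>m N"
    unfolding Units_def by (auto simp: ring_mat_def)
  have "matmul N A (\<lambda>i j. B $$ (i,j)) i j = idmat N i j" if "i < N" "j < N" for i j
  proof -
    have "matmul N A (\<lambda>i j. B $$ (i,j)) i j = (?A * B) $$ (i,j)"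
      using that B(1) by (simp add: matmul_def scalar_prod_def atLeast0LessThan)
    then show ?thesis using that B by (simp add: idmat_def)
  qed
  moreover have "matmul N (\<lambda>i j. B $$ (i,j)) A i j = idmat N i j" if "i < N" "j < N" for i j
  proof -
    have "matmul N (\<lambda>i j. B $$ (i,j)) A i j = (B * ?A) $$ (i,j)"
      using that B(1) by (simp add: matmul_def scalar_prod_def atLeast0LessThan)
    then show ?thesis using that B by (simp add: idmat_def)
  qed
  ultimately show ?thesis by blast
qed

section \<open>Linear independence in coordinates\<close>

definition indep :: "nat \<Rightarrow> nat \<Rightarrow> (nat \<Rightarrow> nat \<Rightarrow> 'a::field) \<Rightarrow> bool" where
  "indep N k c \<longleftrightarrow> (\<forall>a. (\<forall>j<N. (\<Sum>i<k. a i * c i j) = 0) \<longrightarrow> (\<forall>i<k. a i = 0))"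

lemma indepD:
  assumes "indep N k c" and "\<And>j. j < N \<Longrightarrow> (\<Sum>i<k. a i * c i j) = 0" and "i < k"
  shows "a i = 0"
  using assms unfolding indep_def by simp

text \<open>Padding N + 1 vectors with a zero column gives a singular square matrix, whose left
  kernel is a dependency. The bound stops the later inductions, in which the number of independent
  vectors grows.\<close>

lemma indep_bound:
  fixes c :: "nat \<Rightarrow> nat \<Rightarrow> 'a::field"
  assumes "indep N k c"
  shows "k \<le> N"
proof (rule ccontr)
  assume "\<not> k \<le> N"
  then have k: "Suc N \<le> k" by simp
  let ?A = "\<lambda>i j. if j < N then c i j else 0"
  have "detL (Suc N) ?A = 0"
    unfolding detL_eq_0_iff_right_kernel
    by (rule exI[of _ "\<lambda>j. if j = N then 1 else 0"]) (auto intro!: sum.neutral)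
  then obtain e i where e: "i < Suc N" "e i \<noteq> 0"
      "\<forall>j<Suc N. (\<Sum>i<Suc N. e i * ?A i j) = 0"
    unfolding detL_eq_0_iff_left_kernel by blast
  let ?a = "\<lambda>i. if i < Suc N then e i else 0"
  have "(\<Sum>i<k. ?a i * c i j) = 0" if "j < N" for j
  proof -
    have "(\<Sum>i<k. ?a i * c i j) = (\<Sum>i<Suc N. e i * ?A i j)"
      using k that by (intro sum.mono_neutral_cong_right) auto
    also have "\<dots> = 0" using e(3) that less_SucI by blast
    finally show ?thesis .
  qed
  then have "?a i = 0" using e(1) k indepD[OF assms, of ?a i] by simp
  with e(1,2) show False by simp
qed

lemma indep_extend:
  fixes c :: "nat \<Rightarrow> nat \<Rightarrow> 'a::field"
  assumes "indep N k c"
    and "\<not> (\<exists>a. \<forall>j<N. v j = (\<Sum>i<k. a i * c i j))"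
  shows "indep N (Suc k) (c(k := v))"
  unfolding indep_def
proof (intro allI impI)
  fix a i
  assume a: "\<forall>j<N. (\<Sum>i<Suc k. a i * (c(k := v)) i j) = 0" and i: "i < Suc k"
  have a': "(\<Sum>i<k. a i * c i j) + a k * v j = 0" if "j < N" for j
    using a that by simp
  have ak: "a k = 0"
  proof (rule ccontr)
    assume "a k \<noteq> 0"
    then have "v j = (\<Sum>i<k. - (a i / a k) * c i j)" if "j < N" for j
    proof -
      have "(\<Sum>i<k. - (a i / a k) * c i j) = - ((\<Sum>i<k. a i * c i j) / a k)"
        by (simp add: sum_divide_distrib sum_negf)
      also have "\<dots> = v j"
        using a'[OF that] \<open>a k \<noteq> 0\<close> by (simp add: field_simps neg_eq_iff_add_eq_0 add.commute)
      finally show ?thesis by simp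
    qed
    then have "\<exists>a. \<forall>j<N. v j = (\<Sum>i<k. a i * c i j)"
      by (intro exI[of _ "\<lambda>i. - (a i / a k)"]) blast
    with assms(2) show False ..
  qed
  with a' have "a i = 0" if "i < k" for i
    using that by (intro indepD[OF assms(1), of a i]) auto
  with ak i show "a i = 0" by (auto simp: less_Suc_eq)
qed

section \<open>The Cauchy--Binet formula and wedges of vectors\<close>

text \<open>Multilinearity in the rows: \<open>\<phi>\<close> records which summand is chosen in
  each row.\<close>

lemma detL_sum_rows:
  fixes M N :: nat
  shows "detL N (\<lambda>i j. \<Sum>k<M. w i k * h k j) =
     (\<Sum>\<phi> \<in> {..<N} \<rightarrow>\<^sub>E {..<M}. (\<Prod>i<N. w i (\<phi> i)) * detL N (\<lambda>i. h (\<phi> i)))"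
proof -
  have "detL N (\<lambda>i j. \<Sum>k<M. w i k * h k j) =
      (\<Sum>p | p permutes {..<N}. of_int (sign p) *
         (\<Sum>\<phi> \<in> {..<N} \<rightarrow>\<^sub>E {..<M}. \<Prod>i<N. w i (\<phi> i) * h (\<phi> i) (p i)))"
    unfolding detL_def by (simp add: prod_sum_PiE)
  also have "\<dots> = (\<Sum>\<phi> \<in> {..<N} \<rightarrow>\<^sub>E {..<M}. \<Sum>p | p permutes {..<N}.
      of_int (sign p) * (\<Prod>i<N. w i (\<phi> i) * h (\<phi> i) (p i)))"
    unfolding sum_distrib_left by (rule sum.swap)
  also have "\<dots> = (\<Sum>\<phi> \<in> {..<N} \<rightarrow>\<^sub>E {..<M}. (\<Prod>i<N. w i (\<phi> i)) * detL N (\<lambda>i. h (\<phi> i)))"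
    unfolding detL_def sum_distrib_left
    by (intro sum.cong refl) (simp add: prod.distrib mult_ac)
  finally show ?thesis .
qed

lemma ksub_nth_bij:
  assumes "S \<in> ksub n"
  shows "bij_betw (\<lambda>i. sorted_list_of_set S ! i) {..<2*n} S"
proof -
  have S: "S \<subseteq> {..<4*n}" "card S = 2*n" using assms by (auto simp: ksub_def)
  then have "finite S" using finite_subset by blast
  then show ?thesis
    using bij_betw_nth[of "sorted_list_of_set S" "{..<2*n}" S] S by simp
qed

lemma ksub_nth_less:
  assumes "S \<in> ksub n" "i < 2*n"
  shows "sorted_list_of_set S ! i < 4*n"
  using bij_betwE[OF ksub_nth_bij[OF assms(1)]] assms by (auto simp: ksub_def)

text \<open>An injection is determined by its image S and by the permutation that relates it to the
  increasing enumeration of S. This groups the terms of the Cauchy-Binet expansion.\<close>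

lemma injections_bij_betw_subset_perm:
  "bij_betw (\<lambda>(S, p). restrict (\<lambda>i. sorted_list_of_set S ! p i) {..<2*n})
     (ksub n \<times> {p. p permutes {..<2*n}})
     {\<phi> \<in> {..<2*n} \<rightarrow>\<^sub>E {..<4*n}. inj_on \<phi> {..<2*n}}"
  (is "bij_betw ?h ?A ?B")
proof (rule bij_betw_imageI)
  have img: "?h (S, p) ` {..<2*n} = S" if "S \<in> ksub n" "p permutes {..<2*n}" for S p
  proof -
    have "?h (S, p) ` {..<2*n} = (\<lambda>i. sorted_list_of_set S ! i) ` (p ` {..<2*n})"
      by (auto simp: image_image)
    then show ?thesis
      using ksub_nth_bij[OF that(1)] permutes_image[OF that(2)] by (simp add: bij_betw_def)
  qed
  show "inj_on ?h ?A"
  proof (rule inj_onI, clarify)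
    fix S p S' p'
    assume S: "S \<in> ksub n" "S' \<in> ksub n" and p: "p permutes {..<2*n}" "p' permutes {..<2*n}"
      and eq: "restrict (\<lambda>i. sorted_list_of_set S ! p i) {..<2*n} =
        restrict (\<lambda>i. sorted_list_of_set S' ! p' i) {..<2*n}"
    have SS: "S = S'" using img[OF S(1) p(1)] img[OF S(2) p(2)] eq by simp
    have "p i = p' i" for i
    proof (cases "i < 2*n")
      case True
      then have "sorted_list_of_set S ! p i = sorted_list_of_set S ! p' i"
        using fun_cong[OF eq, of i] SS by simp
      moreover have "p i < 2*n" "p' i < 2*n"
        using True permutes_in_image[OF p(1), of i] permutes_in_image[OF p(2), of i] by auto
      ultimately show ?thesis
        using ksub_nth_bij[OF S(1)] unfolding bij_betw_def inj_on_def by simp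
    next
      case False
      then show ?thesis using p by (simp add: permutes_not_in)
    qed
    with SS show "S = S' \<and> p = p'" by auto
  qed
  show "?h ` ?A = ?B"
  proof (intro equalityI subsetI)
    fix \<phi> assume "\<phi> \<in> ?h ` ?A"
    then obtain S p where Sp: "S \<in> ksub n" "p permutes {..<2*n}" "\<phi> = ?h (S, p)" by auto
    have "p i < 2*n" if "i < 2*n" for i using that permutes_in_image[OF Sp(2), of i] by simp
    then have "\<phi> \<in> {..<2*n} \<rightarrow>\<^sub>E {..<4*n}"
      using Sp ksub_nth_less[OF Sp(1)] by auto
    moreover have "inj_on \<phi> {..<2*n}"
      using img[OF Sp(1,2)] Sp by (intro eq_card_imp_inj_on) (auto simp: ksub_def)
    ultimately show "\<phi> \<in> ?B" by simp
  next
    fix \<phi> assume "\<phi> \<in> ?B"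
    then have \<phi>: "\<phi> \<in> {..<2*n} \<rightarrow>\<^sub>E {..<4*n}" "inj_on \<phi> {..<2*n}" by auto
    define S where "S = \<phi> ` {..<2*n}"
    have S: "S \<in> ksub n" using \<phi> by (auto simp: S_def ksub_def card_image)
    let ?e = "\<lambda>i. sorted_list_of_set S ! i"
    \<comment> \<open>The position of \<open>\<phi> i\<close> in the enumeration of its image,
      extended by the identity to a permutation of all naturals.\<close>
    define p where "p i = (if i \<in> {..<2*n} then inv_into {..<2*n} ?e (\<phi> i) else i)" for i
    have b: "bij_betw (inv_into {..<2*n} ?e \<circ> \<phi>) {..<2*n} {..<2*n}"
      using \<phi>(2) bij_betw_inv_into[OF ksub_nth_bij[OF S]]
      by (intro bij_betw_trans[of _ _ S]) (simp_all add: S_def bij_betw_def)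
    have "bij_betw p {..<2*n} {..<2*n}"
      using b by (rule bij_betw_cong[THEN iffD1, rotated]) (simp add: p_def)
    then have p: "p permutes {..<2*n}"
      by (rule bij_imp_permutes) (simp add: p_def)
    have "?e (p i) = \<phi> i" if "i < 2*n" for i
      using that ksub_nth_bij[OF S] by (simp add: p_def S_def bij_betw_def f_inv_into_f)
    then have "\<phi> = ?h (S, p)"
      using \<phi>(1) by (auto simp: fun_eq_iff PiE_def extensional_def)
    then show "\<phi> \<in> ?h ` ?A" using S p by blast
  qed
qed

text \<open>This is Cauchy-Binet. In the multilinear expansion, choices that repeat a row vanish;
  the remaining ones with image S differ by a permutation, and their signs add up to the S-minor of
  \<open>w\<close>. Coordinates on the exterior power can thus be replaced by bases.\<close>

lemma wedge_act_wedge_vecs: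
  "wedge_act n g (wedge_vecs n w) = wedge_vecs n (matmul (4*n) w g)"
proof
  fix T
  show "wedge_act n g (wedge_vecs n w) T = wedge_vecs n (matmul (4*n) w g) T"
  proof (cases "T \<in> ksub n")
    case False
    then show ?thesis by (simp add: wedge_act_def wedge_vecs_def)
  next
    case True
    define h where "h = (\<lambda>k j. g k (sorted_list_of_set T ! j))"
    define F where "F = (\<lambda>\<phi>. (\<Prod>i<2*n. w i (\<phi> i)) * detL (2*n) (\<lambda>i. h (\<phi> i)))"
    have "wedge_vecs n (matmul (4*n) w g) T = detL (2*n) (\<lambda>i j. \<Sum>k<4*n. w i k * h k j)"
      using True by (simp add: wedge_vecs_def matmul_def h_def)
    also have "\<dots> = (\<Sum>\<phi> \<in> {..<2*n} \<rightarrow>\<^sub>E {..<4*n}. F \<phi>)"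
      unfolding F_def by (rule detL_sum_rows)
    also have "\<dots> = (\<Sum>\<phi> \<in> {\<phi> \<in> {..<2*n} \<rightarrow>\<^sub>E {..<4*n}. inj_on \<phi> {..<2*n}}. F \<phi>)"
    proof (rule sum.mono_neutral_right)
      show "\<forall>\<phi> \<in> ({..<2*n} \<rightarrow>\<^sub>E {..<4*n}) - {\<phi> \<in> {..<2*n} \<rightarrow>\<^sub>E {..<4*n}. inj_on \<phi> {..<2*n}}. F \<phi> = 0"
      proof
        fix \<phi> assume "\<phi> \<in> ({..<2*n} \<rightarrow>\<^sub>E {..<4*n}) - {\<phi> \<in> {..<2*n} \<rightarrow>\<^sub>E {..<4*n}. inj_on \<phi> {..<2*n}}"
        then have "\<not> inj_on \<phi> {..<2*n}" by simp
        then obtain i j where "i < 2*n" "j < 2*n" "i \<noteq> j" "\<phi> i = \<phi> j"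
          unfolding inj_on_def by blast
        then have "detL (2*n) (\<lambda>i. h (\<phi> i)) = 0" by (intro detL_identical_rows[of i "2*n" j]) simp_all
        then show "F \<phi> = 0" by (simp add: F_def)
      qed
    qed (auto intro: finite_PiE)
    also have "\<dots> = (\<Sum>x \<in> ksub n \<times> {p. p permutes {..<2*n}}.
        F (case x of (S, p) \<Rightarrow> restrict (\<lambda>i. sorted_list_of_set S ! p i) {..<2*n}))"
      by (rule sum.reindex_bij_betw[OF injections_bij_betw_subset_perm, symmetric])
    also have "\<dots> = (\<Sum>S \<in> ksub n. \<Sum>p | p permutes {..<2*n}.
        F (restrict (\<lambda>i. sorted_list_of_set S ! p i) {..<2*n}))"
      by (subst sum.cartesian_product) (simp add: case_prod_beta)
    also have "\<dots> = (\<Sum>S \<in> ksub n. wedge_vecs n w S *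
        detL (2*n) (\<lambda>i. h (sorted_list_of_set S ! i)))"
    proof (rule sum.cong[OF refl])
      fix S assume S: "S \<in> ksub n"
      let ?s = "\<lambda>i. sorted_list_of_set S ! i"
      have "F (restrict (\<lambda>i. ?s (p i)) {..<2*n}) =
          (of_int (sign p) * (\<Prod>i<2*n. w i (?s (p i)))) * detL (2*n) (\<lambda>i. h (?s i))"
        if "p permutes {..<2*n}" for p
      proof -
        have "detL (2*n) (\<lambda>i. h (restrict (\<lambda>i. ?s (p i)) {..<2*n} i)) = detL (2*n) (\<lambda>i. h (?s (p i)))"
          by (rule detL_cong) simp
        also have "\<dots> = of_int (sign p) * detL (2*n) (\<lambda>i. h (?s i))"
          by (rule detL_permute_rows[OF that, of "\<lambda>i. h (?s i)"])
        finally show ?thesis by (simp add: F_def mult_ac)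
      qed
      then show "(\<Sum>p | p permutes {..<2*n}. F (restrict (\<lambda>i. ?s (p i)) {..<2*n})) =
          wedge_vecs n w S * detL (2*n) (\<lambda>i. h (?s i))"
        using S by (simp add: wedge_vecs_def detL_def[of _ "\<lambda>i j. w i (?s j)"] sum_distrib_right)
    qed
    also have "\<dots> = wedge_act n g (wedge_vecs n w) T"
      using True by (simp add: wedge_act_def h_def)
    finally show ?thesis ..
  qed
qed

lemma wedge_vecs_cong:
  assumes "\<And>i j. i < 2*n \<Longrightarrow> j < 4*n \<Longrightarrow> w i j = w' i j"
  shows "wedge_vecs n w = wedge_vecs n w'"
  unfolding wedge_vecs_def
  using assms ksub_nth_less by (fastforce intro: detL_cong)

lemma wedge_vecs_matmul_left:
  "wedge_vecs n (matmul (2*n) D w) = (\<lambda>S. detL (2*n) D * wedge_vecs n w S)"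
proof
  fix S
  have "detL (2*n) (\<lambda>i j. matmul (2*n) D w i (s j)) = detL (2*n) D * detL (2*n) (\<lambda>i j. w i (s j))"
    for s :: "nat \<Rightarrow> nat"
    using detL_matmul[of "2*n" D "\<lambda>i j. w i (s j)"] by (simp add: matmul_def[abs_def])
  then show "wedge_vecs n (matmul (2*n) D w) S = detL (2*n) D * wedge_vecs n w S"
    by (simp add: wedge_vecs_def)
qed

text \<open>Scalar multiples of a wedge are again wedges, because one vector can absorb the scalar;
  \<open>n \<ge> 1\<close> guarantees that row 0 exists.\<close>

lemma wedge_vecs_scale_row:
  assumes "n \<ge> 1"
  shows "wedge_vecs n (\<lambda>i j. (if i = 0 then t else 1) * w i j) = (\<lambda>S. t * wedge_vecs n w S)"
proof
  fix S
  have "detL (2*n) (\<lambda>i j. (if i = 0 then t else 1) * w i (s j)) = t * detL (2*n) (\<lambda>i j. w i (s j))"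
    for s :: "nat \<Rightarrow> nat"
  proof -
    have "(\<Prod>i<2*n. if i = 0 then t else 1) = t"
      using assms by (simp add: prod.delta)
    then show ?thesis
      by (simp add: detL_def prod.distrib sum_distrib_left mult_ac)
  qed
  then show "wedge_vecs n (\<lambda>i j. (if i = 0 then t else 1) * w i j) S = t * wedge_vecs n w S"
    by (simp add: wedge_vecs_def)
qed

lemma wedge_vecs_eq_0_if_dependent:
  fixes w :: "nat \<Rightarrow> nat \<Rightarrow> 'a::field"
  assumes "\<exists>i<2*n. e i \<noteq> 0" and "\<And>j. j < 4*n \<Longrightarrow> (\<Sum>i<2*n. e i * w i j) = 0"
  shows "wedge_vecs n w = (\<lambda>_. 0)"
proof
  fix S
  have "detL (2*n) (\<lambda>i j. w i (sorted_list_of_set S ! j)) = 0" if "S \<in> ksub n"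
    unfolding detL_eq_0_iff_left_kernel
    using assms ksub_nth_less[OF that] by blast
  then show "wedge_vecs n w S = 0" by (simp add: wedge_vecs_def)
qed

lemma fplus_wedge_vecs: "fplus n (wedge_vecs n w) = detL (2*n) (\<lambda>i j. w i (2*n + j))"
proof -
  have "{2*n..<4*n} \<in> ksub n" by (auto simp: ksub_def)
  then show ?thesis
    by (auto simp: fplus_def wedge_vecs_def intro: detL_cong)
qed

lemma fminus_wedge_vecs: "fminus n (wedge_vecs n w) = detL (2*n) w"
proof -
  have "{..<2*n} \<in> ksub n" by (auto simp: ksub_def)
  then show ?thesis
    by (auto simp: fminus_def wedge_vecs_def lessThan_atLeast0 intro: detL_cong)
qed

section \<open>Polynomial functions of one variable\<close>

text \<open>Polynomiality is stated for functions, so that curves such as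
  \<open>s \<mapsto> f (L s)\<close> need no explicit polynomial; over an infinite field the values
  determine it.\<close>

definition poly_map :: "('a::comm_ring_1 \<Rightarrow> 'a) \<Rightarrow> bool" where
  "poly_map h \<longleftrightarrow> (\<exists>p. h = poly p)"

lemma poly_map_const: "poly_map (\<lambda>s. c)"
  unfolding poly_map_def by (rule exI[of _ "[:c:]"]) auto

lemma poly_map_ident: "poly_map (\<lambda>s. s)"
  unfolding poly_map_def by (rule exI[of _ "[:0,1:]"]) auto

lemma poly_map_add: "poly_map f \<Longrightarrow> poly_map g \<Longrightarrow> poly_map (\<lambda>s. f s + g s)"
  unfolding poly_map_def by (auto simp flip: poly_add)

lemma poly_map_mult: "poly_map f \<Longrightarrow> poly_map g \<Longrightarrow> poly_map (\<lambda>s. f s * g s)"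
  unfolding poly_map_def by (auto simp flip: poly_mult)

lemma poly_map_sum: "(\<And>x. x \<in> A \<Longrightarrow> poly_map (f x)) \<Longrightarrow> poly_map (\<lambda>s. \<Sum>x\<in>A. f x s)"
  by (induction A rule: infinite_finite_induct) (simp_all add: poly_map_const poly_map_add)

lemma poly_map_prod: "(\<And>x. x \<in> A \<Longrightarrow> poly_map (f x)) \<Longrightarrow> poly_map (\<lambda>s. \<Prod>x\<in>A. f x s)"
  by (induction A rule: infinite_finite_induct) (simp_all add: poly_map_const poly_map_mult)

lemma poly_map_detL:
  "(\<And>i j. poly_map (\<lambda>s. A s i j)) \<Longrightarrow> poly_map (\<lambda>s. detL k (A s))"
  unfolding detL_def by (intro poly_map_sum poly_map_mult poly_map_const poly_map_prod) auto

lemma poly_map_wedge_vecs: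
  assumes "\<And>i j. poly_map (\<lambda>s. w s i j)"
  shows "poly_map (\<lambda>s. wedge_vecs n (w s) S)"
proof (cases "S \<in> ksub n")
  case True
  then show ?thesis using assms by (simp add: wedge_vecs_def poly_map_detL)
qed (simp add: wedge_vecs_def poly_map_const)

lemma poly_map_polyfun:
  assumes "polyfun f" and "\<And>S. poly_map (\<lambda>s. L s S)"
  shows "poly_map (\<lambda>s. f (L s))"
  using assms(1)
  by induction (simp_all add: poly_map_const poly_map_add poly_map_mult assms(2))

lemma poly_map_affine: "poly_map (\<lambda>s. a + s * b)"
  by (intro poly_map_add poly_map_mult poly_map_const poly_map_ident)

text \<open>A nonzero polynomial has finitely many roots in an infinite field. This is the
  substitute for density on a curve: nonvanishing at a degenerate point s = 0 spreads to a nearby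
  general point.\<close>

lemma poly_map_nonzero_elsewhere:
  fixes h :: "'a::field_char_0 \<Rightarrow> 'a"
  assumes "poly_map h" and "h 0 \<noteq> 0"
  obtains s where "s \<noteq> 0" and "h s \<noteq> 0"
proof -
  obtain p where p: "h = poly p" using assms(1) by (auto simp: poly_map_def)
  then have "p \<noteq> 0" using assms(2) by auto
  then have "finite (insert 0 {s. poly p s = 0})" by (simp add: poly_roots_finite)
  then obtain s where "s \<notin> insert 0 {s. poly p s = 0}"
    using ex_new_if_finite[OF infinite_UNIV_char_0] by blast
  then show ?thesis using that p by auto
qed

text \<open>From \<open>h x * h (- x) = 1\<close> the polynomial is a unit of the polynomial ring,
  hence constant.\<close>

lemma poly_map_additive_character:
  fixes h :: "'a::field_char_0 \<Rightarrow> 'a"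
  assumes "poly_map h" and add: "\<And>a b. h (a + b) = h a * h b" and "h 0 = 1"
  shows "h a = 1"
proof -
  obtain p where p: "h = poly p" using assms(1) by (auto simp: poly_map_def)
  have "poly (p * pcompose p [:0,-1:]) = poly 1"
  proof
    fix x
    have "poly p x * poly p (- x) = 1" using add[of x "-x"] assms(3) by (simp add: p)
    then show "poly (p * pcompose p [:0,-1:]) x = poly 1 x" by (simp add: poly_pcompose)
  qed
  then have "p * pcompose p [:0,-1:] = 1" by (simp add: poly_eq_poly_eq_iff)
  then have "is_unit p" by (metis dvdI)
  then obtain c where "p = [:c:]" by (auto simp: is_unit_poly_iff)
  then show ?thesis using assms(3) by (simp add: p)
qed

text \<open>For fixed t, the identity p(ta) = h(t) p(a) holds at all nonzero a, hence between
  polynomials in a; comparing leading coefficients gives h(t) as the power of t with exponent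
  \<open>degree p\<close>.\<close>

lemma poly_map_multiplicative_character:
  fixes h :: "'a::field_char_0 \<Rightarrow> 'a"
  assumes "poly_map h" and mult: "\<And>a b. a \<noteq> 0 \<Longrightarrow> b \<noteq> 0 \<Longrightarrow> h (a * b) = h a * h b" and "h 1 = 1"
  shows "\<exists>m. \<forall>t. t \<noteq> 0 \<longrightarrow> h t = t ^ m"
proof -
  obtain p where p: "h = poly p" using assms(1) by (auto simp: poly_map_def)
  then have "p \<noteq> 0" using assms(3) by auto
  have "h t = t ^ degree p" if "t \<noteq> 0" for t
  proof -
    let ?q = "pcompose p [:0,t:] - smult (h t) p"
    have "poly ?q a = 0" if "a \<noteq> 0" for a
      using mult[OF that \<open>t \<noteq> 0\<close>] by (simp add: poly_pcompose p mult.commute)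
    then have "- {0} \<subseteq> {a. poly ?q a = 0}" by auto
    moreover have "infinite (- {0::'a})"
      using infinite_UNIV_char_0 by (simp add: Compl_eq_Diff_UNIV)
    ultimately have "?q = 0" using poly_roots_finite finite_subset by blast
    then have "coeff (pcompose p [:0,t:]) (degree p) = h t * lead_coeff p" by simp
    moreover have "coeff (pcompose p [:0,t:]) (degree p) = t ^ degree p * lead_coeff p"
      using lead_coeff_comp[of "[:0,t:]" p] degree_pcompose[of p "[:0,t:]"] that
      by (simp add: mult.commute)
    ultimately show ?thesis using \<open>p \<noteq> 0\<close> by simp
  qed
  then show ?thesis by blast
qed

lemma polyfun_power: "polyfun f \<Longrightarrow> polyfun (\<lambda>L. f L ^ m)"
  by (induction m) (auto intro: pf_const pf_mult)

lemma polyfun_diff_smult: "polyfun f \<Longrightarrow> polyfun g \<Longrightarrow> polyfun (\<lambda>L. f L - c * g L)"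
  using pf_add[OF _ pf_mult[OF pf_const[of "- c"]], of f g] by simp

lemma polyfun_fplus: "polyfun (fplus n)"
  unfolding fplus_def[abs_def] by (rule pf_coord)

lemma polyfun_fminus: "polyfun (fminus n)"
  unfolding fminus_def[abs_def] by (rule pf_coord)

section \<open>Transvections and characters of the symplectic group\<close>

definition sform :: "nat \<Rightarrow> (nat \<Rightarrow> nat \<Rightarrow> 'a::field) \<Rightarrow> (nat \<Rightarrow> 'a) \<Rightarrow> (nat \<Rightarrow> 'a) \<Rightarrow> 'a" where
  "sform N J u v = (\<Sum>i<N. \<Sum>j<N. u i * J i j * v j)"

definition unitv :: "nat \<Rightarrow> nat \<Rightarrow> 'a::field" where
  "unitv i k = (if k = i then 1 else 0)"

text \<open>Row i is the image of the i-th unit vector under v |-> v + a <v,u> u.\<close>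

definition transv :: "nat \<Rightarrow> (nat \<Rightarrow> nat \<Rightarrow> 'a::field) \<Rightarrow> (nat \<Rightarrow> 'a) \<Rightarrow> 'a \<Rightarrow> nat \<Rightarrow> nat \<Rightarrow> 'a" where
  "transv N J u a i j = (if i < N \<and> j < N then unitv i j + a * sform N J (unitv i) u * u j else 0)"

lemma sform_cong:
  assumes "\<And>i. i < N \<Longrightarrow> u i = u' i" and "\<And>i. i < N \<Longrightarrow> v i = v' i"
  shows "sform N J u v = sform N J u' v'"
  unfolding sform_def using assms by (intro sum.cong refl) auto

lemma sform_add_left: "sform N J (\<lambda>i. u i + v i) w = sform N J u w + sform N J v w"
  by (simp add: sform_def distrib_right sum.distrib)

lemma sform_add_right: "sform N J w (\<lambda>i. u i + v i) = sform N J w u + sform N J w v"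
  by (simp add: sform_def distrib_left sum.distrib)

lemma sform_scale_left: "sform N J (\<lambda>i. a * u i) w = a * sform N J u w"
  by (simp add: sform_def sum_distrib_left mult_ac)

lemma sform_scale_right: "sform N J w (\<lambda>i. a * u i) = a * sform N J w u"
  by (simp add: sform_def sum_distrib_left mult_ac)

lemma sform_diff_left: "sform N J (\<lambda>i. u i - v i) w = sform N J u w - sform N J v w"
  by (simp add: sform_def left_diff_distrib sum_subtractf)

lemma sform_diff_right: "sform N J w (\<lambda>i. u i - v i) = sform N J w u - sform N J w v"
  by (simp add: sform_def right_diff_distrib sum_subtractf)

lemma sform_sum_left:
  "sform N J (\<lambda>j. \<Sum>i\<in>I. a i * c i j) w = (\<Sum>i\<in>I. a i * sform N J (c i) w)"
proof (induction I rule: infinite_finite_induct)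
  case (insert x F)
  then show ?case by (simp add: sform_add_left sform_scale_left)
qed (simp_all add: sform_def)

lemma sform_sum_right:
  "sform N J w (\<lambda>j. \<Sum>i\<in>I. a i * c i j) = (\<Sum>i\<in>I. a i * sform N J w (c i))"
proof (induction I rule: infinite_finite_induct)
  case (insert x F)
  then show ?case by (simp add: sform_add_right sform_scale_right)
qed (simp_all add: sform_def)

lemmas sform_linear = sform_add_left sform_add_right sform_scale_left sform_scale_right
  sform_diff_left sform_diff_right

lemma sform_unitv_right: "j < N \<Longrightarrow> sform N J v (unitv j) = (\<Sum>i<N. v i * J i j)"
  by (simp add: sform_def unitv_def if_distrib[of "\<lambda>x. _ * x"] cong: if_cong)

lemma sform_unitv_unitv: "i < N \<Longrightarrow> j < N \<Longrightarrow> sform N J (unitv i) (unitv j) = J i j"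
  by (simp add: sform_unitv_right) (simp add: unitv_def if_distrib[of "\<lambda>x. x * _"] cong: if_cong)

lemma vec_eq_sum_unitv: "i < N \<Longrightarrow> v i = (\<Sum>k<N. v k * unitv k i)" 
  by (simp add: unitv_def if_distrib[of "\<lambda>x. _ * x"] cong: if_cong)

lemma vecmul_unitv: "i < N \<Longrightarrow> vecmul N (unitv i) g = g i"
  by (rule ext) (simp add: vecmul_def unitv_def if_distrib[of "\<lambda>x. x * _"] cong: if_cong)

lemma vecmul_cong:
  assumes "\<And>i. i < N \<Longrightarrow> u i = v i"
  shows "vecmul N u g = vecmul N v g"
  using assms by (auto simp: vecmul_def intro!: sum.cong)

lemma matmul_row: "matmul N g h i = vecmul N (g i) h"
  by (rule ext) (simp add: matmul_def vecmul_def)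

lemma vecmul_matmul: "vecmul N v (matmul N g h) = vecmul N (vecmul N v g) h"
proof
  fix j
  have "vecmul N v (matmul N g h) j = (\<Sum>i<N. \<Sum>k<N. v i * g i k * h k j)"
    by (simp add: vecmul_def matmul_def sum_distrib_left mult_ac)
  also have "\<dots> = (\<Sum>k<N. \<Sum>i<N. v i * g i k * h k j)"
    by (rule sum.swap)
  also have "\<dots> = vecmul N (vecmul N v g) h j"
    by (simp add: vecmul_def sum_distrib_right)
  finally show "vecmul N v (matmul N g h) j = vecmul N (vecmul N v g) h j" .
qed

lemma vecmul_lincomb:
  "vecmul N (\<lambda>j. \<Sum>i\<in>I. a i * c i j) g j = (\<Sum>i\<in>I. a i * vecmul N (c i) g j)"
proof -
  have "vecmul N (\<lambda>j. \<Sum>i\<in>I. a i * c i j) g j = (\<Sum>k<N. \<Sum>i\<in>I. a i * c i k * g k j)"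
    by (simp add: vecmul_def sum_distrib_right)
  also have "\<dots> = (\<Sum>i\<in>I. \<Sum>k<N. a i * c i k * g k j)"
    by (rule sum.swap)
  finally show ?thesis by (simp add: vecmul_def sum_distrib_left mult_ac)
qed

lemma vecmul_transv:
  "j < N \<Longrightarrow> vecmul N v (transv N J u a) j = v j + a * sform N J v u * u j"
proof -
  assume j: "j < N"
  have "vecmul N v (transv N J u a) j
      = (\<Sum>i<N. v i * unitv i j) + a * (\<Sum>i<N. v i * sform N J (unitv i) u) * u j"
    using j by (simp add: vecmul_def transv_def distrib_left sum.distrib sum_distrib_left
        sum_distrib_right mult_ac)
  also have "(\<Sum>i<N. v i * sform N J (unitv i) u) = sform N J v u"
    unfolding sform_sum_left[symmetric]
    by (rule sform_cong) (simp_all add: vec_eq_sum_unitv[symmetric])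
  finally show ?thesis using vec_eq_sum_unitv[OF j, of v] by simp
qed

lemma poly_map_transv: "poly_map (\<lambda>a. transv N J u a i j)"
  by (cases "i < N \<and> j < N") (auto simp: transv_def mult.assoc poly_map_const poly_map_affine)

lemma Sp_iff:
  "g \<in> Sp n J \<longleftrightarrow> (\<forall>i j. 2*n \<le> i \<or> 2*n \<le> j \<longrightarrow> g i j = 0) \<and>
     (\<forall>i<2*n. \<forall>j<2*n. sform (2*n) J (g i) (g j) = J i j)"
  by (simp add: Sp_def sform_def)

lemma Sp_support: "g \<in> Sp n J \<Longrightarrow> 2*n \<le> i \<or> 2*n \<le> j \<Longrightarrow> g i j = 0"
  by (auto simp: Sp_iff)

lemma Sp_preserves_sform:
  assumes "g \<in> Sp n J"
  shows "sform (2*n) J (vecmul (2*n) u g) (vecmul (2*n) v g) = sform (2*n) J u v"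
proof -
  have "sform (2*n) J (vecmul (2*n) u g) (vecmul (2*n) v g) =
      (\<Sum>i<2*n. u i * (\<Sum>j<2*n. v j * sform (2*n) J (g i) (g j)))"
    by (simp add: vecmul_def[abs_def] sform_sum_left sform_sum_right)
  also have "\<dots> = (\<Sum>i<2*n. u i * (\<Sum>j<2*n. v j * J i j))"
    using assms by (simp add: Sp_iff)
  finally show ?thesis by (simp add: sform_def sum_distrib_left mult_ac)
qed

lemma matmul_Sp:
  assumes "g \<in> Sp n J" "h \<in> Sp n J"
  shows "matmul (2*n) g h \<in> Sp n J"
proof -
  have "matmul (2*n) g h i j = 0" if "2*n \<le> i \<or> 2*n \<le> j" for i j
    using that Sp_support[OF assms(1)] Sp_support[OF assms(2)]
    by (auto simp: matmul_def intro!: sum.neutral)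
  then show ?thesis
    using assms by (simp add: Sp_iff[of "matmul (2*n) g h"] matmul_row Sp_preserves_sform)
      (simp add: Sp_iff)
qed

lemma idmat_Sp:
  fixes J :: "nat \<Rightarrow> nat \<Rightarrow> 'a::field"
  shows "idmat (2*n) \<in> Sp n J"
proof -
  have "idmat (2*n) i = (unitv i :: nat \<Rightarrow> 'a)" if "i < 2*n" for i
    using that by (auto simp: idmat_def unitv_def)
  then show ?thesis by (auto simp: Sp_iff sform_unitv_unitv idmat_def)
qed

section \<open>The symplectic space and its transvections\<close>

locale symplectic =
  fixes n :: nat and J :: "nat \<Rightarrow> nat \<Rightarrow> 'a::field_char_0"
  assumes n_pos: "n \<ge> 1" and gram: "symplectic_gram n J"
begin

abbreviation B :: "(nat \<Rightarrow> 'a) \<Rightarrow> (nat \<Rightarrow> 'a) \<Rightarrow> 'a" where "B \<equiv> sform (2*n) J"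
abbreviation T :: "(nat \<Rightarrow> 'a) \<Rightarrow> 'a \<Rightarrow> nat \<Rightarrow> nat \<Rightarrow> 'a" where "T \<equiv> transv (2*n) J"

lemma J_antisym: "J i j = - J j i"
  using gram unfolding symplectic_gram_def by blast

lemma B_antisym: "B u v = - B v u"
proof -
  have "B u v = (\<Sum>j<2*n. \<Sum>i<2*n. u i * J i j * v j)"
    unfolding sform_def by (rule sum.swap)
  also have "\<dots> = (\<Sum>j<2*n. \<Sum>i<2*n. - (v j * J j i * u i))"
    by (intro sum.cong refl, subst J_antisym) simp
  finally show ?thesis by (simp add: sform_def sum_negf)
qed

text \<open>Antisymmetry makes the form alternating because 2 is invertible in characteristic
  zero.\<close>

lemma B_self: "B u u = 0"
  using B_antisym[of u u] by simp

lemma B_nondegenerate: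
  assumes "i < 2*n" "u i \<noteq> 0"
  obtains j where "j < 2*n" "B u (unitv j) \<noteq> 0"
proof -
  have "\<exists>j<2*n. (\<Sum>i<2*n. u i * J i j) \<noteq> 0"
    using gram assms unfolding symplectic_gram_def by blast
  then show ?thesis using that by (auto simp: sform_unitv_right)
qed

lemma transv_row:
  assumes "i < 2*n"
  shows "\<And>j. j < 2*n \<Longrightarrow> T u a i j = unitv i j + a * B (unitv i) u * u j"
  using assms by (simp add: transv_def)

text \<open>The terms linear in a cancel by antisymmetry, and the quadratic one carries the factor
  \<open>B u u\<close>.\<close>

lemma transv_Sp: "T u a \<in> Sp n J"
proof -
  have "B (T u a i) (T u a j) = J i j" if "i < 2*n" "j < 2*n" for i j
  proof -
    have "B (T u a i) (T u a j) = B (\<lambda>k. unitv i k + a * B (unitv i) u * u k)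
        (\<lambda>k. unitv j k + a * B (unitv j) u * u k)"
      using that by (intro sform_cong) (simp_all add: transv_row)
    also have "\<dots> = J i j + a * B (unitv i) u * (B (unitv j) u + B u (unitv j))"
      using that by (simp add: sform_linear sform_unitv_unitv B_self) (simp add: algebra_simps)
    also have "\<dots> = J i j" using B_antisym[of u "unitv j"] by simp
    finally show ?thesis .
  qed
  then show ?thesis by (auto simp: Sp_iff transv_def)
qed

lemma transv_0: "T u 0 = idmat (2*n)"
  by (intro ext) (auto simp: transv_def idmat_def unitv_def)

lemma transv_add: "T u (a + b) = matmul (2*n) (T u a) (T u b)"
proof (intro ext)
  fix i j
  show "T u (a + b) i j = matmul (2*n) (T u a) (T u b) i j"
  proof (cases "i < 2*n \<and> j < 2*n")
    case True
    have "B (T u a i) u = B (\<lambda>k. unitv i k + a * B (unitv i) u * u k) u"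
      using True by (intro sform_cong) (simp_all add: transv_row)
    also have "\<dots> = B (unitv i) u" by (simp add: sform_linear B_self)
    finally show ?thesis
      using True by (simp add: matmul_row vecmul_transv transv_row) (simp add: algebra_simps)
  next
    case False
    then show ?thesis
      using Sp_support[OF matmul_Sp[OF transv_Sp[of u a] transv_Sp[of u b]], of i j]
      by (auto simp: transv_def)
  qed
qed

text \<open>Multiplying \<open>g\<close> by the transvection along \<open>u = v - v g\<close> that takes \<open>v g\<close> back to \<open>v\<close> makes \<open>v\<close>
  a fixed vector; the vectors fixed by \<open>g\<close> are orthogonal to \<open>u\<close> and so remain fixed.\<close>
lemma character_trivial_step:
  fixes k :: nat
  assumes trans: "\<And>u a h. h \<in> Sp n J \<Longrightarrow> \<chi> (matmul (2*n) h (T u a)) = \<chi> h"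
    and IH: "\<And>h c. h \<in> Sp n J \<Longrightarrow> indep (2*n) (Suc k) c \<Longrightarrow>
        (\<And>i j. i < Suc k \<Longrightarrow> j < 2*n \<Longrightarrow> vecmul (2*n) (c i) h j = c i j) \<Longrightarrow> \<chi> h = 1"
    and g: "g \<in> Sp n J" and c: "indep (2*n) k c"
    and fixed: "\<And>i j. i < k \<Longrightarrow> j < 2*n \<Longrightarrow> vecmul (2*n) (c i) g j = c i j"
    and v: "B v (vecmul (2*n) v g) \<noteq> 0"
  shows "\<chi> g = 1"
proof -
  let ?m = "vecmul (2*n)"
  define u where "u = (\<lambda>j. v j - ?m v g j)"
  \<comment> \<open>Since \<open>B (?m v g) u = B (?m v g) v\<close>, this value makes the
    transvection add exactly \<open>u\<close> to \<open>v g\<close>, and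
    \<open>v g + u = v\<close>.\<close>
  define a where "a = 1 / B (?m v g) v"
  define h where "h = matmul (2*n) g (T u a)"
  have v': "B (?m v g) v \<noteq> 0" using v B_antisym[of v "?m v g"] by auto
  have Bu: "B (c i) u = 0" if "i < k" for i
  proof -
    have "B (c i) (?m v g) = B (?m (c i) g) (?m v g)"
      using fixed[OF that] by (intro sform_cong) auto
    also have "\<dots> = B (c i) v" by (rule Sp_preserves_sform[OF g])
    finally show ?thesis by (simp add: u_def sform_linear)
  qed
  have fix1: "?m (c i) h j = c i j" if "i < k" "j < 2*n" for i j
  proof -
    have "?m (c i) h = ?m (c i) (T u a)"
      unfolding h_def vecmul_matmul using fixed[OF that(1)] by (intro vecmul_cong) auto
    then show ?thesis using that Bu by (simp add: vecmul_transv)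
  qed
  have fix2: "?m v h j = v j" if "j < 2*n" for j
  proof -
    have "a * B (?m v g) u = 1"
      using v' by (simp add: u_def sform_linear B_self a_def)
    then show ?thesis
      using that by (simp add: h_def vecmul_matmul vecmul_transv) (simp add: u_def)
  qed
  \<comment> \<open>In the span of the fixed vectors \<open>v\<close> would itself be fixed, so that
    \<open>B v (?m v g) = B v v = 0\<close>.\<close>
  have "\<not> (\<exists>b. \<forall>j<2*n. v j = (\<Sum>i<k. b i * c i j))"
  proof
    assume "\<exists>b. \<forall>j<2*n. v j = (\<Sum>i<k. b i * c i j)"
    then obtain b where b: "\<forall>j<2*n. v j = (\<Sum>i<k. b i * c i j)" by blast
    have "?m v g j = v j" if "j < 2*n" for j
    proof -
      have "?m v g j = ?m (\<lambda>j. \<Sum>i<k. b i * c i j) g j"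
        using b by (subst vecmul_cong[of "2*n" v]) auto
      then show ?thesis using b fixed that by (simp add: vecmul_lincomb)
    qed
    then have "B v (?m v g) = B v v" by (intro sform_cong) auto
    with v show False by (simp add: B_self)
  qed
  then have "indep (2*n) (Suc k) (c(k := v))" by (rule indep_extend[OF c])
  then have "\<chi> h = 1"
  proof (rule IH[rotated])
    show "h \<in> Sp n J" unfolding h_def by (intro matmul_Sp g transv_Sp)
    show "?m ((c(k := v)) i) h j = (c(k := v)) i j" if "i < Suc k" "j < 2*n" for i j
      using that fix1 fix2 by (auto simp: less_Suc_eq)
  qed
  then show ?thesis using trans[OF g, of u a] by (simp add: h_def)
qed

text \<open>This is the generation of Sp(V) by transvections, phrased for functions invariant under
  them so that no generated subgroup has to be formed. Each round adds a vector to an independent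
  family fixed by \<open>g\<close>; more than 2n of them cannot exist, so the process can only end
  at the identity.\<close>

lemma character_trivial_induct:
  assumes trans: "\<And>u a h. h \<in> Sp n J \<Longrightarrow> \<chi> (matmul (2*n) h (T u a)) = \<chi> h"
    and one: "\<chi> (idmat (2*n)) = 1"
    and "g \<in> Sp n J" "indep (2*n) k c"
    and "\<And>i j. i < k \<Longrightarrow> j < 2*n \<Longrightarrow> vecmul (2*n) (c i) g j = c i j"
  shows "\<chi> g = 1"
  using assms(3-)
proof (induction "Suc (2*n) - k" arbitrary: k g c)
  case 0
  then show ?case using indep_bound[of "2*n" k c] by simp
next
  case (Suc d)
  note g = \<open>g \<in> Sp n J\<close> and c = \<open>indep (2*n) k c\<close> and fixed = Suc.prems(3)
  have IH: "\<And>h c. h \<in> Sp n J \<Longrightarrow> indep (2*n) (Suc k) c \<Longrightarrow>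
        (\<And>i j. i < Suc k \<Longrightarrow> j < 2*n \<Longrightarrow> vecmul (2*n) (c i) h j = c i j) \<Longrightarrow> \<chi> h = 1"
    using Suc.hyps(1)[of "Suc k"] Suc.hyps(2) by (simp add: Suc_diff_Suc)
  let ?m = "vecmul (2*n)"
  show ?case
  proof (cases "g = idmat (2*n)")
    case True
    then show ?thesis using one by simp
  next
    case False
    then obtain i j where ij: "g i j \<noteq> idmat (2*n) i j" by (auto simp: fun_eq_iff)
    then have lt: "i < 2*n" "j < 2*n"
      using Sp_support[OF g, of i j] by (auto simp: idmat_def split: if_splits intro: ccontr)
    \<comment> \<open>Row i of \<open>g\<close> differs from that of the identity, so this unit
      vector is moved and \<open>u\<close> below is nonzero.\<close>
    define v0 :: "nat \<Rightarrow> 'a" where "v0 = unitv i"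
    define u where "u = (\<lambda>j. ?m v0 g j - v0 j)"
    have "u j \<noteq> 0"
      using ij lt by (auto simp: u_def v0_def vecmul_unitv idmat_def unitv_def split: if_splits)
    then obtain l where "B u (unitv l) \<noteq> 0" using B_nondegenerate[OF lt(2)] by blast
    then obtain v where v: "B v u \<noteq> 0" using B_antisym[of "unitv l" u] by fastforce
    show ?thesis
    proof (cases "\<exists>v. B v (?m v g) \<noteq> 0")
      case True
      then obtain v where v: "B v (?m v g) \<noteq> 0" by blast
      show ?thesis by (rule character_trivial_step[OF trans IH g c fixed v])
    next
      case False
      \<comment> \<open>No \<open>v\<close> is available for the step, but there is one after a preliminary transvection
        along \<open>u = v\<^sub>0 g - v\<^sub>0\<close>, which also keeps the vectors fixed by \<open>g\<close>.\<close>
      then have zero: "B v (?m v g) = 0" for v by blast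
      define h where "h = matmul (2*n) g (T u 1)"
      have h: "h \<in> Sp n J" unfolding h_def by (intro matmul_Sp g transv_Sp)
      have Bu: "B (c i) u = 0" if "i < k" for i
      proof -
        have "B (c i) (?m v0 g) = B (?m (c i) g) (?m v0 g)"
          using fixed[OF that] by (intro sform_cong) auto
        also have "\<dots> = B (c i) v0" by (rule Sp_preserves_sform[OF g])
        finally show ?thesis by (simp add: u_def sform_linear)
      qed
      have fix1: "?m (c i) h j = c i j" if "i < k" "j < 2*n" for i j
      proof -
        have "?m (c i) h = ?m (c i) (T u 1)"
          unfolding h_def vecmul_matmul using fixed[OF that(1)] by (intro vecmul_cong) auto
        then show ?thesis using that Bu by (simp add: vecmul_transv)
      qed
      \<comment> \<open>Polarising the identity \<open>zero\<close> yields
        \<open>B (?m v g) u = - B v u\<close>; the preliminary transvection then turns the pairing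
        of \<open>v\<close> with its image into minus the square of \<open>B v u\<close>, which is
        nonzero.\<close>
      have polar: "B v (?m v0 g) + B v0 (?m v g) = 0"
      proof -
        have "?m (\<lambda>j. v j + v0 j) g = (\<lambda>j. ?m v g j + ?m v0 g j)"
          by (rule ext) (simp add: vecmul_def distrib_right sum.distrib)
        then show ?thesis
          using zero[of "\<lambda>j. v j + v0 j"] zero[of v] zero[of v0] by (simp add: sform_linear)
      qed
      have "B (?m v g) u = B v v0 - B (?m v g) v0"
        by (simp add: u_def sform_linear Sp_preserves_sform[OF g])
      also have "\<dots> = - B v u"
        using polar unfolding B_antisym[of "?m v g" v0]
        by (simp add: u_def sform_linear eq_neg_iff_add_eq_0 add.commute)
      finally have gu: "B (?m v g) u = - B v u" .
      have "B v (?m v h) = B v (\<lambda>j. ?m v g j + B (?m v g) u * u j)"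
        by (intro sform_cong) (simp_all add: h_def vecmul_matmul vecmul_transv)
      also have "\<dots> = - (B v u * B v u)"
        by (simp add: sform_linear zero gu)
      finally have vh: "B v (?m v h) \<noteq> 0" using v by simp
      have "\<chi> h = 1" by (rule character_trivial_step[OF trans IH h c fix1 vh])
      then show ?thesis using trans[OF g, of u 1] by (simp add: h_def)
    qed
  qed
qed

lemma Sp_character_trivial:
  assumes mult: "\<And>g h. g \<in> Sp n J \<Longrightarrow> h \<in> Sp n J \<Longrightarrow> \<chi> (matmul (2*n) g h) = \<chi> g * \<chi> h"
    and one: "\<chi> (idmat (2*n)) = 1"
    and poly: "\<And>u. poly_map (\<lambda>a. \<chi> (T u a))"
    and "g \<in> Sp n J"
  shows "\<chi> g = 1"
\<comment> \<open>The induction starts from the empty family of fixed vectors, k = 0.\<close>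
proof (rule character_trivial_induct[of \<chi> g 0 "\<lambda>_ _. 0"])
  fix u a h assume h: "h \<in> Sp n J"
  have "\<chi> (T u a) = 1"
    by (rule poly_map_additive_character[OF poly]) (simp_all add: transv_add mult transv_Sp transv_0 one)
  then show "\<chi> (matmul (2*n) h (T u a)) = \<chi> h" by (simp add: mult h transv_Sp)
qed (use assms in \<open>auto simp: indep_def\<close>)

lemma Sp_detL: "g \<in> Sp n J \<Longrightarrow> detL (2*n) g = 1"
proof (rule Sp_character_trivial[of "detL (2*n)"])
  fix u
  show "poly_map (\<lambda>a. detL (2*n) (T u a))" by (intro poly_map_detL poly_map_transv)
qed (simp_all add: detL_matmul detL_idmat)

end

section \<open>The variety of lagrangians\<close>

lemma sum_lessThan_double:
  fixes f :: "nat \<Rightarrow> 'b::comm_monoid_add"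
  shows "(\<Sum>k<4*n. f k) = (\<Sum>k<2*n. f k) + (\<Sum>k<2*n. f (2*n + k))"
proof -
  have "(\<Sum>k<4*n. f k) = (\<Sum>k\<in>{0..<2*n}. f k) + (\<Sum>k\<in>{2*n..<4*n}. f k)"
    by (simp add: lessThan_atLeast0 sum.atLeastLessThan_concat)
  also have "(\<Sum>k\<in>{2*n..<4*n}. f k) = (\<Sum>k\<in>{0..<2*n}. f (2*n + k))"
    using sum.shift_bounds_nat_ivl[of f 0 "2*n" "2*n"] by (simp add: add.commute)
  finally show ?thesis by (simp add: lessThan_atLeast0)
qed

lemma matmul_blockdiag_plus:
  "j < 2*n \<Longrightarrow> matmul (4*n) w (blockdiag n g1 g2) i j = vecmul (2*n) (w i) g1 j"
  by (simp add: matmul_def vecmul_def sum_lessThan_double blockdiag_def)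

lemma matmul_blockdiag_minus:
  "j < 2*n \<Longrightarrow> matmul (4*n) w (blockdiag n g1 g2) i (2*n + j) = vecmul (2*n) (\<lambda>k. w i (2*n + k)) g2 j"
  by (simp add: matmul_def vecmul_def sum_lessThan_double blockdiag_def)

lemma hact_wedge_vecs:
  "hact n (\<lambda>S. s * wedge_vecs n w S) (t, g1, g2) =
     (\<lambda>S. s * t * wedge_vecs n (matmul (4*n) w (blockdiag n g1 g2)) S)"
proof
  fix S
  have "wedge_act n g (\<lambda>S. s * L S) S = s * wedge_act n g L S" for g L
    by (simp add: wedge_act_def sum_distrib_left mult.assoc)
  then show "hact n (\<lambda>S. s * wedge_vecs n w S) (t, g1, g2) S =
      s * t * wedge_vecs n (matmul (4*n) w (blockdiag n g1 g2)) S"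
    by (simp add: hact_def wedge_act_wedge_vecs mult_ac)
qed

lemma hact_zero: "hact n (\<lambda>_. 0) h = (\<lambda>_. 0)"
  by (auto simp: hact_def wedge_act_def split: prod.splits)

lemma vecmul_idmat: "j < N \<Longrightarrow> vecmul N v (idmat N) j = v j"
  by (simp add: vecmul_def idmat_def if_distrib[of "\<lambda>x. _ * x"] cong: if_cong)

lemma idmat_matmul_Sp:
  assumes "g \<in> Sp n J"
  shows "matmul (2*n) (idmat (2*n)) g = g"
proof (intro ext)
  fix i j
  show "matmul (2*n) (idmat (2*n)) g i j = g i j"
    using Sp_support[OF assms, of i j]
    by (cases "i < 2*n") (simp_all add: matmul_def idmat_def if_distrib[of "\<lambda>x. x * _"] cong: if_cong)
qed

text \<open>The rows span the lagrangian of all \<open>(v g, v)\<close>.\<close>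
definition graph_basis :: "nat \<Rightarrow> (nat \<Rightarrow> nat \<Rightarrow> 'a::field) \<Rightarrow> nat \<Rightarrow> nat \<Rightarrow> 'a" where
  "graph_basis n g i j = (if j < 2*n then g i j else unitv i (j - 2*n))"

lemma fplus_graph_basis: "fplus n (wedge_vecs n (graph_basis n g)) = 1"
proof -
  have "detL (2*n) (\<lambda>i j. graph_basis n g i (2*n + j)) = detL (2*n) (idmat (2*n))"
    by (rule detL_cong) (auto simp: graph_basis_def idmat_def unitv_def)
  then show ?thesis by (simp add: fplus_wedge_vecs detL_idmat)
qed

lemma fminus_graph_basis: "fminus n (wedge_vecs n (graph_basis n g)) = detL (2*n) g"
  unfolding fminus_wedge_vecs by (rule detL_cong) (simp add: graph_basis_def)

text \<open>In the coordinates (s, g) on the open orbit, (t, h, 1) acts by right translation;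
  eigenfunctions there are determined by their value at (1, identity).\<close>

lemma hact_graph_basis:
  "hact n (\<lambda>S. s * wedge_vecs n (graph_basis n g) S) (t, h, idmat (2*n)) =
     (\<lambda>S. s * t * wedge_vecs n (graph_basis n (matmul (2*n) g h)) S)"
proof -
  have "wedge_vecs n (matmul (4*n) (graph_basis n g) (blockdiag n h (idmat (2*n)))) =
      wedge_vecs n (graph_basis n (matmul (2*n) g h))"
  proof (rule wedge_vecs_cong)
    fix i j assume "i < 2*n" "j < 4*n"
    show "matmul (4*n) (graph_basis n g) (blockdiag n h (idmat (2*n))) i j =
        graph_basis n (matmul (2*n) g h) i j"
    proof (cases "j < 2*n")
      case True
      have "vecmul (2*n) (graph_basis n g i) h = vecmul (2*n) (g i) h"
        by (rule vecmul_cong) (simp add: graph_basis_def)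
      with True show ?thesis
        by (simp add: matmul_blockdiag_plus graph_basis_def[of n "matmul (2*n) g h"] matmul_row[of "2*n"])
    next
      case False
      then obtain j' where j': "j = 2*n + j'" "j' < 2*n"
        using \<open>j < 4*n\<close> le_Suc_ex[of "2*n" j] by auto
      then show ?thesis
        by (simp add: matmul_blockdiag_minus vecmul_idmat) (simp add: graph_basis_def)
    qed
  qed
  then show ?thesis unfolding hact_wedge_vecs by simp
qed

context symplectic
begin

section \<open>The form on the doubled space\<close>

lemma bform_eq: "bform n J u v = B u v - B (\<lambda>i. u (2*n + i)) (\<lambda>i. v (2*n + i))"
  by (simp add: bform_def sform_def)

lemma bform_add_left: "bform n J (\<lambda>i. u i + v i) w = bform n J u w + bform n J v w"
  by (simp add: bform_eq sform_linear)

lemma bform_add_right: "bform n J w (\<lambda>i. u i + v i) = bform n J w u + bform n J w v"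
  by (simp add: bform_eq sform_linear)

lemma bform_scale_left: "bform n J (\<lambda>i. a * u i) w = a * bform n J u w"
  by (simp add: bform_eq sform_linear algebra_simps)

lemma bform_scale_right: "bform n J w (\<lambda>i. a * u i) = a * bform n J w u"
  by (simp add: bform_eq sform_linear algebra_simps)

lemmas bform_linear = bform_add_left bform_add_right bform_scale_left bform_scale_right

lemma bform_antisym: "bform n J u v = - bform n J v u"
  unfolding bform_eq using B_antisym[of u v] B_antisym[of "\<lambda>i. u (2*n + i)" "\<lambda>i. v (2*n + i)"]
  by simp

lemma bform_self: "bform n J u u = 0"
  by (simp add: bform_eq B_self)

lemma bform_sum_left:
  "bform n J (\<lambda>j. \<Sum>i\<in>I. a i * c i j) w = (\<Sum>i\<in>I. a i * bform n J (c i) w)"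
  by (simp add: bform_eq sform_sum_left sum_subtractf right_diff_distrib)

text \<open>An isometry makes the two halves of the doubled form cancel on the graph, and the value
  1 of \<open>fplus\<close> shows that the wedge is nonzero.\<close>

lemma lagr_basis_graph:
  assumes "g \<in> Sp n J"
  shows "lagr_basis n J (graph_basis n g)"
proof -
  have "bform n J (graph_basis n g i) (graph_basis n g j) = 0" if "i < 2*n" "j < 2*n" for i j
  proof -
    have "B (graph_basis n g i) (graph_basis n g j) = B (g i) (g j)"
      by (rule sform_cong) (simp_all add: graph_basis_def)
    moreover have "(\<lambda>k. graph_basis n g i (2*n + k)) = unitv i" for i
      by (rule ext) (simp add: graph_basis_def)
    ultimately show ?thesis
      using assms that by (simp add: bform_eq Sp_iff sform_unitv_unitv)
  qed
  moreover have "wedge_vecs n (graph_basis n g) \<noteq> (\<lambda>_. 0)"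
  proof
    assume "wedge_vecs n (graph_basis n g) = (\<lambda>_. 0)"
    then show False using fplus_graph_basis[of n g] by (simp add: fplus_def)
  qed
  ultimately show ?thesis by (simp add: lagr_basis_def)
qed

lemma XP_scale:
  assumes "x \<in> XP n J" "t \<noteq> 0"
  shows "(\<lambda>S. t * x S) \<in> XP n J"
proof -
  obtain w where w: "x = wedge_vecs n w" "lagr_basis n J w"
    using assms(1) by (auto simp: XP_def)
  let ?w = "\<lambda>i j. (if i = 0 then t else 1) * w i j"
  have eq: "wedge_vecs n ?w = (\<lambda>S. t * x S)"
    unfolding w(1) by (rule wedge_vecs_scale_row[OF n_pos])
  have "lagr_basis n J ?w"
    unfolding lagr_basis_def eq
    using w assms(2) by (auto simp: lagr_basis_def bform_scale_left bform_scale_right fun_eq_iff)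
  then show ?thesis
    unfolding XP_def by (intro CollectI exI[of _ ?w] conjI) (simp_all only: eq)
qed

section \<open>Graphs and the open orbit\<close>

lemma scaled_graph_XP:
  "g \<in> Sp n J \<Longrightarrow> t \<noteq> 0 \<Longrightarrow> (\<lambda>S. t * wedge_vecs n (graph_basis n g) S) \<in> XP n J"
  using lagr_basis_graph by (intro XP_scale) (auto simp: XP_def)

lemma graph_XP: "g \<in> Sp n J \<Longrightarrow> wedge_vecs n (graph_basis n g) \<in> XP n J"
  using scaled_graph_XP[of g 1] by simp

text \<open>On a wedge, \<open>fplus\<close> is the determinant of the \<open>V^-\<close> block, and
  a left kernel vector of this block is a combination of the basis that lies in \<open>V^+\<close>.
  This identifies the boundary of the embedding with the zero locus of \<open>fplus\<close>.\<close>

lemma Xplus_iff: "x \<in> Xplus n J \<longleftrightarrow> x \<in> Xvar n J \<and> fplus n x \<noteq> 0"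
proof
  assume "x \<in> Xplus n J"
  then obtain w where w: "x = wedge_vecs n w" "lagr_basis n J w"
    and triv: "\<And>c. (\<forall>j. 2*n \<le> j \<and> j < 4*n \<longrightarrow> (\<Sum>i<2*n. c i * w i j) = 0) \<Longrightarrow>
        (\<forall>j<4*n. (\<Sum>i<2*n. c i * w i j) = 0)"
    unfolding Xplus_def by blast
  have "fplus n x \<noteq> 0"
  proof
    assume "fplus n x = 0"
    then obtain e where e: "\<exists>i<2*n. e i \<noteq> 0" "\<forall>j<2*n. (\<Sum>i<2*n. e i * w i (2*n + j)) = 0"
      unfolding w(1) fplus_wedge_vecs detL_eq_0_iff_left_kernel by blast
    have "(\<Sum>i<2*n. e i * w i j) = 0" if "2*n \<le> j" "j < 4*n" for j
      using e(2)[rule_format, of "j - 2*n"] that by simp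
    then have "\<forall>j<4*n. (\<Sum>i<2*n. e i * w i j) = 0" using triv by blast
    then have "wedge_vecs n w = (\<lambda>_. 0)"
      using e(1) by (intro wedge_vecs_eq_0_if_dependent[of n e]) auto
    then show False using w(2) by (simp add: lagr_basis_def)
  qed
  then show "x \<in> Xvar n J \<and> fplus n x \<noteq> 0"
    using w by (auto simp: Xvar_def XP_def)
next
  assume x: "x \<in> Xvar n J \<and> fplus n x \<noteq> 0"
  then obtain w where w: "x = wedge_vecs n w" "lagr_basis n J w"
    by (auto simp: Xvar_def XP_def fplus_def)
  have "(\<Sum>i<2*n. c i * w i j) = 0"
    if c: "\<forall>j. 2*n \<le> j \<and> j < 4*n \<longrightarrow> (\<Sum>i<2*n. c i * w i j) = 0" for c j
  proof -
    have "\<forall>j<2*n. (\<Sum>i<2*n. c i * w i (2*n + j)) = 0" using c by simp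
    then have "\<forall>i<2*n. c i = 0"
      using x unfolding w(1) fplus_wedge_vecs detL_eq_0_iff_left_kernel by blast
    then show ?thesis by simp
  qed
  then show "x \<in> Xplus n J" unfolding Xplus_def using w by blast
qed

text \<open>The \<open>V^-\<close> block \<open>D\<close> is invertible, so a base change by its
  inverse \<open>E\<close> makes that block the identity and the \<open>V^+\<close> block the matrix
  \<open>g\<close>. Undoing the base change costs the factor \<open>detL (2*n) D\<close>, which is
  \<open>fplus n x\<close>.\<close>

lemma Xplus_is_graph:
  assumes "x \<in> Xplus n J"
  obtains g where "g \<in> Sp n J" and "x = (\<lambda>S. fplus n x * wedge_vecs n (graph_basis n g) S)"
proof -
  obtain w where w: "x = wedge_vecs n w" "lagr_basis n J w"
    using assms by (auto simp: Xplus_def)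
  define D where "D = (\<lambda>i j. w i (2*n + j))"
  have det: "detL (2*n) D = fplus n x" by (simp add: w(1) fplus_wedge_vecs D_def)
  then have "detL (2*n) D \<noteq> 0" using assms by (simp add: Xplus_iff)
  then obtain E where DE: "\<And>i j. i < 2*n \<Longrightarrow> j < 2*n \<Longrightarrow> matmul (2*n) D E i j = idmat (2*n) i j"
    and ED: "\<And>i j. i < 2*n \<Longrightarrow> j < 2*n \<Longrightarrow> matmul (2*n) E D i j = idmat (2*n) i j"
    using detL_inverse[of "2*n" D] by blast
  define g where "g = (\<lambda>i j. if i < 2*n \<and> j < 2*n then matmul (2*n) E w i j else 0)"
  have BwD: "B (w k) (w l) = B (D k) (D l)" if "k < 2*n" "l < 2*n" for k l
    using w(2) that by (simp add: lagr_basis_def bform_eq D_def)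
  have "B (g i) (g j) = J i j" if ij: "i < 2*n" "j < 2*n" for i j
  proof -
    have expand: "B (\<lambda>m. \<Sum>k<2*n. E i k * Z k m) (\<lambda>m. \<Sum>l<2*n. E j l * Z l m) =
        (\<Sum>k<2*n. E i k * (\<Sum>l<2*n. E j l * B (Z k) (Z l)))" for Z
      by (simp add: sform_sum_left sform_sum_right)
    have row: "(\<Sum>k<2*n. E i k * D k m) = unitv i m" if "i < 2*n" "m < 2*n" for i m
      using ED[OF that] that by (auto simp: matmul_def idmat_def unitv_def)
    have "B (g i) (g j) = B (\<lambda>m. \<Sum>k<2*n. E i k * w k m) (\<lambda>m. \<Sum>l<2*n. E j l * w l m)"
      using ij by (intro sform_cong) (simp_all add: g_def matmul_def)
    \<comment> \<open>Isotropy says that the \<open>V^+\<close> and \<open>V^-\<close> parts of the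
      basis have equal Gram matrices, so \<open>w\<close> may be exchanged for \<open>D\<close>;
      this is what makes \<open>g\<close> symplectic.\<close>
    also have "\<dots> = B (\<lambda>m. \<Sum>k<2*n. E i k * D k m) (\<lambda>m. \<Sum>l<2*n. E j l * D l m)"
      unfolding expand by (simp add: BwD)
    also have "\<dots> = B (unitv i) (unitv j)"
      using ij by (intro sform_cong) (simp_all add: row)
    finally show ?thesis using ij by (simp add: sform_unitv_unitv)
  qed
  then have g: "g \<in> Sp n J" by (auto simp: Sp_iff g_def)
  have "wedge_vecs n w = wedge_vecs n (matmul (2*n) D (graph_basis n g))"
  proof (rule wedge_vecs_cong)
    fix i j assume i: "i < 2*n" and j: "j < 4*n"
    show "w i j = matmul (2*n) D (graph_basis n g) i j"
    proof (cases "j < 2*n")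
      case True
      have "matmul (2*n) D (graph_basis n g) i j = (\<Sum>k<2*n. \<Sum>l<2*n. D i k * E k l * w l j)"
        using True by (simp add: matmul_def graph_basis_def g_def sum_distrib_left mult_ac)
      also have "\<dots> = (\<Sum>l<2*n. matmul (2*n) D E i l * w l j)"
        unfolding matmul_def sum_distrib_right by (rule sum.swap)
      also have "\<dots> = (\<Sum>l<2*n. idmat (2*n) i l * w l j)"
        using DE i by simp
      also have "\<dots> = w i j"
        using i by (simp add: idmat_def if_distrib[of "\<lambda>x. x * _"] cong: if_cong)
      finally show ?thesis by simp
    next
      case False
      then have "matmul (2*n) D (graph_basis n g) i j = (\<Sum>k<2*n. D i k * unitv k (j - 2*n))"
        by (simp add: matmul_def graph_basis_def)
      also have "\<dots> = D i (j - 2*n)"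
        using False j by (subst vec_eq_sum_unitv[of "j - 2*n" "2*n" "D i"]) auto
      finally show ?thesis using False by (simp add: D_def)
    qed
  qed
  then have "x = (\<lambda>S. fplus n x * wedge_vecs n (graph_basis n g) S)"
    by (simp add: w(1)[symmetric] wedge_vecs_matmul_left det)
  with g show ?thesis by (rule that)
qed

text \<open>The \<open>V^-\<close> block is multiplied by \<open>g2\<close>, which has determinant
  1, so only the scalar survives.\<close>

lemma fplus_hact:
  assumes "x \<in> Xvar n J" "(t, g1, g2) \<in> Hgrp n J"
  shows "fplus n (hact n x (t, g1, g2)) = t * fplus n x"
proof (cases "x = (\<lambda>_. 0)")
  case True
  then show ?thesis by (simp add: hact_zero fplus_def)
next
  case False
  then obtain w where w: "x = wedge_vecs n w" using assms by (auto simp: Xvar_def XP_def)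
  let ?w = "matmul (4*n) w (blockdiag n g1 g2)"
  have "hact n x (t, g1, g2) = (\<lambda>S. t * wedge_vecs n ?w S)"
    using hact_wedge_vecs[of n 1 w t g1 g2] by (simp add: w)
  then have "fplus n (hact n x (t, g1, g2)) = t * fplus n (wedge_vecs n ?w)"
    by (simp add: fplus_def)
  also have "fplus n (wedge_vecs n ?w) = detL (2*n) (matmul (2*n) (\<lambda>i j. w i (2*n + j)) g2)"
    unfolding fplus_wedge_vecs
    by (rule detL_cong) (simp add: matmul_blockdiag_minus matmul_row[of "2*n"])
  also have "\<dots> = fplus n x"
    using assms Sp_detL[of g2] by (simp add: detL_matmul w fplus_wedge_vecs Hgrp_def)
  finally show ?thesis .
qed

lemma hact_Xvar:
  assumes "x \<in> Xvar n J" "h \<in> Hgrp n J"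
  shows "hact n x h \<in> Xvar n J"
proof (cases "x = (\<lambda>_. 0)")
  case True
  then show ?thesis by (simp add: hact_zero Xvar_def)
next
  case False
  then obtain w where w: "x = wedge_vecs n w" "lagr_basis n J w"
    using assms by (auto simp: Xvar_def XP_def)
  obtain t g1 g2 where h: "h = (t, g1, g2)" "t \<noteq> 0" "g1 \<in> Sp n J" "g2 \<in> Sp n J"
    using assms(2) by (auto simp: Hgrp_def)
  let ?w = "matmul (4*n) w (blockdiag n g1 g2)"
  have eq: "hact n x h = (\<lambda>S. t * wedge_vecs n ?w S)"
    using hact_wedge_vecs[of n 1 w t g1 g2] by (simp add: w h)
  have "bform n J (?w i) (?w j) = bform n J (w i) (w j)" for i j
  proof -
    have "B (?w i) (?w j) = B (vecmul (2*n) (w i) g1) (vecmul (2*n) (w j) g1)"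
      by (rule sform_cong) (simp_all add: matmul_blockdiag_plus)
    moreover have "B (\<lambda>k. ?w i (2*n + k)) (\<lambda>k. ?w j (2*n + k)) =
        B (vecmul (2*n) (\<lambda>k. w i (2*n + k)) g2) (vecmul (2*n) (\<lambda>k. w j (2*n + k)) g2)"
      by (rule sform_cong) (simp_all add: matmul_blockdiag_minus)
    ultimately show ?thesis using h by (simp add: bform_eq Sp_preserves_sform)
  qed
  \<comment> \<open>Isotropy suffices here, since a vanishing wedge would also be a point of
    X.\<close>
  then have "wedge_vecs n ?w = (\<lambda>_. 0) \<or> wedge_vecs n ?w \<in> XP n J"
    using w(2) by (auto simp: XP_def lagr_basis_def)
  then show ?thesis using XP_scale[OF _ h(2)] by (auto simp: eq Xvar_def)
qed

text \<open>Induction on the rank of the \<open>V\<^sup>-\<close>-component \<open>D\<close> of the basis. If \<open>e D = 0\<close> and \<open>D y = 0\<close>, the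
  transvection along a vector \<open>u\<close> whose \<open>V\<^sup>+\<close>-part pairs nontrivially with \<open>e w\<close> and whose
  \<open>V\<^sup>-\<close>-part is not orthogonal to \<open>y\<close> (so lies outside the row space of \<open>D\<close>) raises the rank.\<close>
lemma exists_basis_off_Vplus:
  assumes f: "polyfun f"
    and "lagr_basis n J w" "f (wedge_vecs n w) \<noteq> 0"
    and "indep (2*n) k (\<lambda>i j. \<Sum>l<2*n. c i l * w l (2*n + j))"
  shows "\<exists>w'. lagr_basis n J w' \<and> f (wedge_vecs n w') \<noteq> 0 \<and> fplus n (wedge_vecs n w') \<noteq> 0"
  using assms(2-)
proof (induction "Suc (2*n) - k" arbitrary: k w c)
  case 0
  then show ?case using indep_bound[of "2*n" k] by fastforce
next
  case (Suc d)
  note w = \<open>lagr_basis n J w\<close> and fw = \<open>f (wedge_vecs n w) \<noteq> 0\<close>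
  show ?case
  proof (cases "fplus n (wedge_vecs n w) = 0")
    case False
    then show ?thesis using w fw by blast
  next
    case True
    let ?D = "\<lambda>i j. w i (2*n + j)"
    from True have det: "detL (2*n) ?D = 0" by (simp add: fplus_wedge_vecs)
    then obtain e where e: "\<exists>i<2*n. e i \<noteq> 0" "\<forall>j<2*n. (\<Sum>i<2*n. e i * w i (2*n + j)) = 0"
      unfolding detL_eq_0_iff_left_kernel by blast
    from det obtain y j0 where y: "j0 < 2*n" "y j0 \<noteq> 0"
        "\<forall>i<2*n. (\<Sum>j<2*n. w i (2*n + j) * y j) = 0"
      unfolding detL_eq_0_iff_right_kernel by blast
    define v where "v = (\<lambda>j. \<Sum>i<2*n. e i * w i j)"
    have "\<exists>j<2*n. v j \<noteq> 0"
    proof (rule ccontr)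
      assume "\<not> (\<exists>j<2*n. v j \<noteq> 0)"
      then have "(\<Sum>i<2*n. e i * w i j) = 0" if "j < 4*n" for j
        using e(2)[rule_format, of "j - 2*n"] that by (cases "j < 2*n") (auto simp: v_def)
      then have "wedge_vecs n w = (\<lambda>_. 0)"
        using e(1) by (intro wedge_vecs_eq_0_if_dependent[of n e]) auto
      then show False using w by (simp add: lagr_basis_def)
    qed
    then obtain l where l: "B v (unitv l) \<noteq> 0" using B_nondegenerate by metis
    \<comment> \<open>Both halves can be unit vectors: \<open>l\<close> was chosen with
      \<open>B v (unitv l) \<noteq> 0\<close>, and \<open>y j0 \<noteq> 0\<close>.\<close>
    define u :: "nat \<Rightarrow> 'a" where "u = (\<lambda>j. if j < 2*n then unitv l j else unitv j0 (j - 2*n))"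
    define \<beta> where "\<beta> i = bform n J (w i) u" for i
    define ws where "ws s i j = w i j + s * (\<beta> i * u j)" for s i j
    have ws0: "ws 0 = w" by (simp add: ws_def fun_eq_iff)
    have "(\<Sum>i<2*n. e i * \<beta> i) = bform n J v u"
      by (simp add: \<beta>_def v_def bform_sum_left)
    also have "\<dots> = B v (unitv l) - B (\<lambda>_. 0) (unitv j0)"
    proof -
      have "B v u = B v (unitv l)" by (rule sform_cong) (simp_all add: u_def)
      moreover have "B (\<lambda>i. v (2*n + i)) (\<lambda>i. u (2*n + i)) = B (\<lambda>_. 0) (unitv j0)"
        using e(2) by (intro sform_cong) (simp_all add: u_def v_def)
      ultimately show ?thesis by (simp add: bform_eq)
    qed
    also have "\<dots> = B v (unitv l)" by (simp add: sform_def)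
    finally have e\<beta>: "(\<Sum>i<2*n. e i * \<beta> i) \<noteq> 0" using l by simp
    obtain S0 where S0: "wedge_vecs n w S0 \<noteq> 0" using w by (auto simp: lagr_basis_def fun_eq_iff)
    have wedge_poly: "poly_map (\<lambda>s. wedge_vecs n (ws s) S)" for S
      by (rule poly_map_wedge_vecs) (simp add: ws_def poly_map_affine)
    \<comment> \<open>The factor at \<open>S0\<close> ensures that the same s keeps both
      \<open>f\<close> and the wedge itself nonzero.\<close>
    have "poly_map (\<lambda>s. f (wedge_vecs n (ws s)) * wedge_vecs n (ws s) S0)"
      by (intro poly_map_mult poly_map_polyfun[OF f] wedge_poly)
    then obtain s where s: "s \<noteq> 0" "f (wedge_vecs n (ws s)) * wedge_vecs n (ws s) S0 \<noteq> 0"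
      by (rule poly_map_nonzero_elsewhere) (use S0 fw ws0 in auto)
    have iso: "bform n J (ws s i) (ws s j) = 0" if "i < 2*n" "j < 2*n" for i j
    proof -
      have "bform n J (ws s i) (ws s j) =
          bform n J (w i) (w j) + s * \<beta> i * (\<beta> j + bform n J u (w j))"
        unfolding ws_def[abs_def]
        by (simp add: bform_linear bform_self \<beta>_def[symmetric]) (simp add: algebra_simps)
      also have "\<dots> = 0"
        using w that bform_antisym[of u "w j"] by (simp add: lagr_basis_def \<beta>_def)
      finally show ?thesis .
    qed
    have lag: "lagr_basis n J (ws s)"
      using iso s(2) by (auto simp: lagr_basis_def)
    \<comment> \<open>Coefficients rather than vectors are carried along because the basis moves
      with s. The new combination \<open>e\<close> had zero \<open>V^-\<close> part; it now has the
      part \<open>s * \<gamma> k * unitv j0 j\<close>, where \<open>\<gamma> k\<close> is the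
      nonzero sum of the \<open>e i * \<beta> i\<close>.\<close>
    let ?c = "c(k := e)"
    define \<gamma> where "\<gamma> i = (\<Sum>l<2*n. ?c i l * \<beta> l)" for i
    have row: "(\<Sum>l<2*n. ?c i l * ws s l (2*n + j)) =
        (\<Sum>l<2*n. ?c i l * w l (2*n + j)) + s * \<gamma> i * unitv j0 j" for i j
      by (simp add: ws_def u_def \<gamma>_def distrib_left sum.distrib sum_distrib_left sum_distrib_right mult_ac)
    have "indep (2*n) (Suc k) (\<lambda>i j. \<Sum>l<2*n. ?c i l * ws s l (2*n + j))"
      unfolding indep_def
    proof (intro allI impI)
      fix a i
      assume a: "\<forall>j<2*n. (\<Sum>i<Suc k. a i * (\<Sum>l<2*n. ?c i l * ws s l (2*n + j))) = 0"
        and i: "i < Suc k"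
      \<comment> \<open>The total coefficient of \<open>unitv j0\<close> in the relation. Pairing
        the relation with \<open>y\<close> kills the row space of the old block and leaves
        \<open>\<theta> * y j0\<close>, so \<open>\<theta> = 0\<close> and the old independence
        applies.\<close>
      define \<theta> where "\<theta> = (\<Sum>i<Suc k. a i * (s * \<gamma> i))"
      define b where "b l = (\<Sum>i<k. a i * c i l)" for l
      have key: "(\<Sum>i<k. a i * (\<Sum>l<2*n. c i l * w l (2*n + j))) + \<theta> * unitv j0 j = 0"
        if "j < 2*n" for j
      proof -
        have "(\<Sum>i<Suc k. a i * (\<Sum>l<2*n. ?c i l * w l (2*n + j))) + \<theta> * unitv j0 j = 0"
          using a[rule_format, OF that] unfolding row \<theta>_def
          by (simp only: distrib_left sum.distrib sum_distrib_right mult.assoc)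
        then show ?thesis using e(2) that by simp
      qed
      have "(\<Sum>i<k. a i * (\<Sum>l<2*n. c i l * w l (2*n + j))) = (\<Sum>l<2*n. b l * w l (2*n + j))" for j
      proof -
        have "(\<Sum>i<k. a i * (\<Sum>l<2*n. c i l * w l (2*n + j))) =
            (\<Sum>i<k. \<Sum>l<2*n. a i * c i l * w l (2*n + j))"
          by (simp add: sum_distrib_left mult.assoc)
        also have "\<dots> = (\<Sum>l<2*n. \<Sum>i<k. a i * c i l * w l (2*n + j))" by (rule sum.swap)
        finally show ?thesis by (simp add: b_def sum_distrib_right)
      qed
      then have "(\<Sum>j<2*n. (\<Sum>i<k. a i * (\<Sum>l<2*n. c i l * w l (2*n + j))) * y j) =
          (\<Sum>j<2*n. \<Sum>l<2*n. b l * (w l (2*n + j) * y j))"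
        by (simp add: sum_distrib_right mult.assoc)
      also have "\<dots> = (\<Sum>l<2*n. b l * (\<Sum>j<2*n. w l (2*n + j) * y j))"
        by (subst sum.swap) (simp add: sum_distrib_left)
      also have "\<dots> = 0" using y(3) by simp
      finally have 1: "(\<Sum>j<2*n. (\<Sum>i<k. a i * (\<Sum>l<2*n. c i l * w l (2*n + j))) * y j) = 0" .
      have "0 = (\<Sum>j<2*n. ((\<Sum>i<k. a i * (\<Sum>l<2*n. c i l * w l (2*n + j))) + \<theta> * unitv j0 j) * y j)"
        using key by simp
      also have "\<dots> = (\<Sum>j<2*n. (\<Sum>i<k. a i * (\<Sum>l<2*n. c i l * w l (2*n + j))) * y j) +
          \<theta> * (\<Sum>j<2*n. unitv j0 j * y j)"
        by (simp only: distrib_right sum.distrib sum_distrib_left mult.assoc)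
      also have "(\<Sum>j<2*n. unitv j0 j * y j) = y j0"
        using y(1) by (simp add: unitv_def if_distrib[of "\<lambda>x. x * _"] cong: if_cong)
      finally have "\<theta> = 0" using 1 y(2) by simp
      then have ai: "a i = 0" if "i < k" for i
        using indepD[OF Suc.prems(3), of a i] key that by simp
      then have "\<theta> = a k * (s * (\<Sum>l<2*n. e l * \<beta> l))"
        by (simp add: \<theta>_def \<gamma>_def)
      then have "a k = 0" using \<open>\<theta> = 0\<close> s(1) e\<beta> by simp
      then show "a i = 0" using ai i by (auto simp: less_Suc_eq)
    qed
    moreover have "d = Suc (2*n) - Suc k" using Suc.hyps(2) by simp
    ultimately show ?thesis
      using Suc.hyps(1)[of "Suc k" "ws s" ?c] lag s(2) by simp
  qed
qed

lemma Xplus_dense: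
  assumes f: "polyfun f" and "x \<in> Xvar n J" "f x \<noteq> 0"
  shows "\<exists>x'\<in>Xplus n J. f x' \<noteq> 0"
proof (cases "x = (\<lambda>_. 0)")
  case True
  \<comment> \<open>The origin is not the wedge of a lagrangian; it is approached along the ray of
    multiples of the diagonal point.\<close>
  define x0 :: "'a wedge" where "x0 = wedge_vecs n (graph_basis n (idmat (2*n)))"
  have "poly_map (\<lambda>s. f (\<lambda>S. s * x0 S))"
    by (intro poly_map_polyfun[OF f] poly_map_mult poly_map_ident poly_map_const)
  then obtain s where s: "s \<noteq> 0" "f (\<lambda>S. s * x0 S) \<noteq> 0"
    by (rule poly_map_nonzero_elsewhere) (use assms True in auto)
  have "(\<lambda>S. s * x0 S) \<in> XP n J"
    unfolding x0_def using s(1) by (intro scaled_graph_XP idmat_Sp)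
  moreover have "fplus n (\<lambda>S. s * x0 S) = s"
    using fplus_graph_basis[of n "idmat (2*n) :: nat \<Rightarrow> nat \<Rightarrow> 'a"] by (simp add: fplus_def x0_def)
  ultimately have "(\<lambda>S. s * x0 S) \<in> Xplus n J"
    using s(1) by (simp add: Xplus_iff Xvar_def)
  with s show ?thesis by blast
next
  case False
  then obtain w where w: "x = wedge_vecs n w" "lagr_basis n J w"
    using assms by (auto simp: Xvar_def XP_def)
  have "\<exists>w'. lagr_basis n J w' \<and> f (wedge_vecs n w') \<noteq> 0 \<and> fplus n (wedge_vecs n w') \<noteq> 0"
    by (rule exists_basis_off_Vplus[OF f w(2), where k = 0 and c = "\<lambda>_ _. 0"])
      (use assms w in \<open>auto simp: indep_def\<close>)
  then obtain w' where w': "lagr_basis n J w'" "f (wedge_vecs n w') \<noteq> 0"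
      "fplus n (wedge_vecs n w') \<noteq> 0"
    by blast
  have "wedge_vecs n w' \<in> Xplus n J"
    using w' by (auto simp: Xplus_iff Xvar_def XP_def)
  with w' show ?thesis by blast
qed

section \<open>Relative invariants, determined on the open orbit\<close>

lemma polyfun_eq_on_Xvar:
  assumes "polyfun f" "polyfun g" and "\<And>x. x \<in> Xplus n J \<Longrightarrow> f x = c * g x" and "x \<in> Xvar n J"
  shows "f x = c * g x"
  using Xplus_dense[OF polyfun_diff_smult[OF assms(1,2), of c] assms(4)] assms(3) by auto

text \<open>On the graph of \<open>g\<close> the two functions take the values 1 and det g = 1, and
  density extends the equality. Hence either sign may be used in the classification.\<close>

lemma fplus_eq_fminus:
  assumes "x \<in> Xvar n J"
  shows "fplus n x = fminus n x"
proof -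
  have "fplus n x = 1 * fminus n x"
  proof (rule polyfun_eq_on_Xvar[OF polyfun_fplus polyfun_fminus _ assms])
    fix x assume "x \<in> Xplus n J"
    then obtain g where g: "g \<in> Sp n J" "x = (\<lambda>S. fplus n x * wedge_vecs n (graph_basis n g) S)"
      by (rule Xplus_is_graph)
    have "fminus n x = fplus n x * fminus n (wedge_vecs n (graph_basis n g))"
      by (subst g(2)) (simp add: fminus_def)
    then show "fplus n x = 1 * fminus n x" using g(1) by (simp add: fminus_graph_basis Sp_detL)
  qed
  then show ?thesis by simp
qed

lemma rel_inv_fplus_power:
  assumes "\<And>h. h \<in> Hgrp n J \<Longrightarrow> \<omega> h = fst h ^ m"
  shows "rel_inv n J (\<lambda>x. fplus n x ^ m) \<omega>"
  unfolding rel_inv_def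
proof (intro conjI ballI)
  show "polyfun (\<lambda>x. fplus n x ^ m)" by (rule polyfun_power[OF polyfun_fplus])
  have "wedge_vecs n (graph_basis n (idmat (2*n))) \<in> Xvar n J"
    using graph_XP[OF idmat_Sp] by (simp add: Xvar_def)
  then show "\<exists>x\<in>Xvar n J. fplus n x ^ m \<noteq> 0"
    by (rule bexI[rotated]) (simp add: fplus_graph_basis)
  fix x h assume "x \<in> Xvar n J" "h \<in> Hgrp n J"
  then show "fplus n (hact n x h) ^ m = \<omega> h * fplus n x ^ m"
    using assms[of h] by (cases h) (simp add: fplus_hact power_mult_distrib)
qed

lemma rel_inv_eq_fplus_power:
  assumes "rel_inv n J f \<omega>"
  shows "\<exists>c m. c \<noteq> 0 \<and> (\<forall>x\<in>Xvar n J. f x = c * fplus n x ^ m)"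
proof -
  have f: "polyfun f" and equiv: "\<And>x h. x \<in> Xvar n J \<Longrightarrow> h \<in> Hgrp n J \<Longrightarrow> f (hact n x h) = \<omega> h * f x"
    using assms by (auto simp: rel_inv_def)
  \<comment> \<open>The function \<open>f\<close> in the coordinates (t, g) of the open
    orbit.\<close>
  define q where "q t g = f (\<lambda>S. t * wedge_vecs n (graph_basis n g) S)" for t g
  define \<eta> where "\<eta> t g = \<omega> (t, g, idmat (2*n))" for t g
  let ?I = "idmat (2*n) :: nat \<Rightarrow> nat \<Rightarrow> 'a"
  have q: "q (s * t) (matmul (2*n) g h) = \<eta> t h * q s g"
    if "s \<noteq> 0" "t \<noteq> 0" "g \<in> Sp n J" "h \<in> Sp n J" for s t g h
  proof -
    have "(t, h, ?I) \<in> Hgrp n J" using that idmat_Sp[of n J] by (simp add: Hgrp_def)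
    moreover have "(\<lambda>S. s * wedge_vecs n (graph_basis n g) S) \<in> Xvar n J"
      using scaled_graph_XP[of g s] that by (simp add: Xvar_def)
    ultimately show ?thesis
      using equiv[of "\<lambda>S. s * wedge_vecs n (graph_basis n g) S" "(t, h, ?I)"]
      by (simp add: q_def \<eta>_def hact_graph_basis)
  qed
  have q1: "q t g = \<eta> t g * q 1 ?I" if "t \<noteq> 0" "g \<in> Sp n J" for t g
    using q[of 1 t ?I g] that idmat_Sp[of n J] by (simp add: idmat_matmul_Sp)
  have on_Xplus: "\<exists>g\<in>Sp n J. fplus n x \<noteq> 0 \<and> f x = q (fplus n x) g" if "x \<in> Xplus n J" for x
    using Xplus_is_graph[OF that] that unfolding q_def Xplus_iff by metis
  obtain x1 where "x1 \<in> Xplus n J" "f x1 \<noteq> 0"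
    using assms Xplus_dense unfolding rel_inv_def by blast
  \<comment> \<open>By \<open>q1\<close> all values of \<open>f\<close> on the open orbit are
    multiples of its value at the diagonal, so that value cannot vanish.\<close>
  then have c: "q 1 ?I \<noteq> 0" using on_Xplus q1 by (metis mult_zero_right)
  have \<eta>_mult: "\<eta> (s * t) (matmul (2*n) g h) = \<eta> s g * \<eta> t h"
    if "s \<noteq> 0" "t \<noteq> 0" "g \<in> Sp n J" "h \<in> Sp n J" for s t g h
    using q[OF that] q1[of s g] q1[of "s * t" "matmul (2*n) g h"] that c matmul_Sp[OF that(3,4)]
    by (simp add: mult.commute)
  \<comment> \<open>Through this quotient by a constant the eigencharacter becomes polynomial
    wherever \<open>q\<close> is.\<close>
  have \<eta>_q: "\<eta> t g = q t g / q 1 ?I" if "t \<noteq> 0" "g \<in> Sp n J" for t g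
    using q1[OF that] c by simp
  have \<eta>_Sp: "\<eta> 1 g = 1" if "g \<in> Sp n J" for g
  proof (rule Sp_character_trivial[of "\<eta> 1", OF _ _ _ that])
    show "\<eta> 1 (matmul (2*n) g h) = \<eta> 1 g * \<eta> 1 h" if "g \<in> Sp n J" "h \<in> Sp n J" for g h
      using \<eta>_mult[of 1 1 g h] that by simp
    show "\<eta> 1 ?I = 1" using \<eta>_q[of 1 ?I] idmat_Sp[of n J] c by simp
    fix u
    have "poly_map (\<lambda>a. graph_basis n (T u a) i j)" for i j
      by (cases "j < 2*n") (auto simp: graph_basis_def poly_map_const poly_map_transv)
    then have "poly_map (\<lambda>a. q 1 (T u a) * (1 / q 1 ?I))"
      unfolding q_def by (intro poly_map_mult poly_map_const poly_map_polyfun[OF f] poly_map_wedge_vecs)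
    then show "poly_map (\<lambda>a. \<eta> 1 (T u a))" by (simp add: \<eta>_q transv_Sp)
  qed
  have "\<exists>m. \<forall>t. t \<noteq> 0 \<longrightarrow> q t ?I * (1 / q 1 ?I) = t ^ m"
  proof (rule poly_map_multiplicative_character)
    show "poly_map (\<lambda>t. q t ?I * (1 / q 1 ?I))"
      unfolding q_def by (intro poly_map_mult poly_map_const poly_map_polyfun[OF f] poly_map_ident)
    show "q (s * t) ?I * (1 / q 1 ?I) = q s ?I * (1 / q 1 ?I) * (q t ?I * (1 / q 1 ?I))"
      if "s \<noteq> 0" "t \<noteq> 0" for s t
      using \<eta>_mult[OF that idmat_Sp idmat_Sp] that idmat_Sp[of n J]
      by (simp add: idmat_matmul_Sp[OF idmat_Sp[of n J]] \<eta>_q)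
  qed (use c in simp)
  then obtain m where m: "\<And>t. t \<noteq> 0 \<Longrightarrow> \<eta> t ?I = t ^ m"
    using \<eta>_q[OF _ idmat_Sp] by auto
  have "f x = q 1 ?I * fplus n x ^ m" if x: "x \<in> Xplus n J" for x
  proof -
    obtain g where g: "g \<in> Sp n J" "fplus n x \<noteq> 0" "f x = q (fplus n x) g"
      using on_Xplus[OF x] by blast
    have "\<eta> (fplus n x) g = \<eta> (fplus n x) ?I * \<eta> 1 g"
      using \<eta>_mult[of "fplus n x" 1 ?I g] g idmat_Sp[of n J] by (simp add: idmat_matmul_Sp)
    then show ?thesis using g q1[of "fplus n x" g] \<eta>_Sp m by simp
  qed
  then have "f x = q 1 ?I * fplus n x ^ m" if "x \<in> Xvar n J" for x
    using that by (rule polyfun_eq_on_Xvar[OF f polyfun_power[OF polyfun_fplus]])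
  with c show ?thesis by blast
qed

end

theorem mainTheorem13:
  fixes n :: nat and J :: "nat \<Rightarrow> nat \<Rightarrow> 'a::field_char_0"
  assumes "n \<ge> 1" and "symplectic_gram n J"
  shows
    "(\<forall>f \<omega>. rel_inv n J f \<omega> \<longrightarrow>
        (\<exists>c m. c \<noteq> 0 \<and> (\<forall>x\<in>Xvar n J. f x = c * fplus n x ^ m)) \<and>
        (\<exists>c m. c \<noteq> 0 \<and> (\<forall>x\<in>Xvar n J. f x = c * fminus n x ^ m)))
   \<and> (\<forall>\<omega>. (\<exists>f. rel_inv n J f \<omega>) \<longleftrightarrow>
        (\<exists>m::nat. \<forall>h\<in>Hgrp n J. \<omega> h = fst h ^ m))
   \<and> (\<forall>k::nat. k > 0 \<longrightarrow> (\<exists>h\<in>Hgrp n J. fst h ^ k \<noteq> 1))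
   \<and> Xvar n J - Xplus n J = {x\<in>Xvar n J. fplus n x = 0}
   \<and> rel_inv n J (fplus n) fst"
proof -
  interpret symplectic n J using assms by unfold_locales
  show ?thesis
  proof (intro conjI allI impI iffI)
    fix f \<omega> assume "rel_inv n J f \<omega>"
    then have "\<exists>c m. c \<noteq> 0 \<and> (\<forall>x\<in>Xvar n J. f x = c * fplus n x ^ m)"
      by (rule rel_inv_eq_fplus_power)
    then show "\<exists>c m. c \<noteq> 0 \<and> (\<forall>x\<in>Xvar n J. f x = c * fplus n x ^ m)"
      and "\<exists>c m. c \<noteq> 0 \<and> (\<forall>x\<in>Xvar n J. f x = c * fminus n x ^ m)"
      using fplus_eq_fminus by auto
  next
    fix \<omega> assume "\<exists>f. rel_inv n J f \<omega>"
    then obtain f where f: "rel_inv n J f \<omega>" by blast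
    then obtain c m where cm: "c \<noteq> 0" "\<And>x. x \<in> Xvar n J \<Longrightarrow> f x = c * fplus n x ^ m"
      using rel_inv_eq_fplus_power by blast
    obtain x where x: "x \<in> Xvar n J" "f x \<noteq> 0"
      using f unfolding rel_inv_def by blast
    \<comment> \<open>The transformation rules of \<open>f\<close> and of
      \<open>fplus n x ^ m\<close> are compared at a point where \<open>f\<close> does not
      vanish.\<close>
    have "\<omega> h = fst h ^ m" if h: "h \<in> Hgrp n J" for h
    proof -
      have "\<omega> h * f x = f (hact n x h)" using f x(1) h by (simp add: rel_inv_def)
      also have "\<dots> = fst h ^ m * f x"
        using cm(2)[OF hact_Xvar[OF x(1) h]] cm(2)[OF x(1)] fplus_hact[OF x(1)] h
        by (cases h) (simp add: power_mult_distrib)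
      finally show ?thesis using x(2) by simp
    qed
    then show "\<exists>m. \<forall>h\<in>Hgrp n J. \<omega> h = fst h ^ m" by blast
  next
    fix \<omega> :: "'a \<times> (nat \<Rightarrow> nat \<Rightarrow> 'a) \<times> (nat \<Rightarrow> nat \<Rightarrow> 'a) \<Rightarrow> 'a"
    assume "\<exists>m. \<forall>h\<in>Hgrp n J. \<omega> h = fst h ^ m"
    then show "\<exists>f. rel_inv n J f \<omega>" using rel_inv_fplus_power by blast
  next
    fix k :: nat assume "k > 0"
    \<comment> \<open>The scalar 2 has infinite order in characteristic zero. Hence the powers of
      the generator are distinct, the monoid is free of rank one, and its cone is a ray, so
      simplicial.\<close>
    have "(2::'a) ^ k \<noteq> 1"
    proof
      assume "(2::'a) ^ k = 1"
      then have "of_nat (2 ^ k) = (of_nat 1 :: 'a)" by simp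
      then have "(2::nat) ^ k = 1" by (simp only: of_nat_eq_iff)
      then show False using \<open>k > 0\<close> by simp
    qed
    moreover have "(2, idmat (2*n), idmat (2*n)) \<in> Hgrp n J"
      using idmat_Sp[of n J] by (simp add: Hgrp_def)
    ultimately show "\<exists>h\<in>Hgrp n J. fst h ^ k \<noteq> 1"
      by (metis fst_conv)
  next
    show "Xvar n J - Xplus n J = {x \<in> Xvar n J. fplus n x = 0}"
      by (auto simp: Xplus_iff)
    show "rel_inv n J (fplus n) fst"
      using rel_inv_fplus_power[of fst 1] by simp
  qed
qed

end
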